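(* Let $(\mathsf{FP}_1)$ be the fluid problem under the multinomial logit model and $(\mathsf{FP}_2)$ its convex conic relaxation, as defined in the context. Say that the trade-off condition holds if for each $j\in\mathcal J$, $t\in\{0,1,\dots,T\}$, $k_1\in\mathcal K_{jt}\setminus\overline{\mathcal K}_{jt}$, and $k_2\in\mathcal K_{jt}\setminus\underline{\mathcal K}_{jt}$, one has $\phi_{k_1,t}\le\phi_{k_2,t}$. Then: 1. If $(\mathsf{FP}_2)$ is infeasible, then $(\mathsf{FP}_1)$ is infeasible. 2. If $(\mathsf{FP}_2)$ is feasible, then: (a) $(\mathsf{FP}_2)$ is unbounded if and only if the trade-off condition fails (i.e. $\phi_{k_1,t}>\phi_{k_2,t}$ for some such $j,t,k_1,k_2$). In this case: (i) if $(\mathsf{FP}_2)$ has no feasible solution $(d',d_0',u')$ with $d'>0$, then $(\mathsf{FP}_1)$ is infeasible; (ii) if $(\mathsf{FP}_2)$ has a feasible solution $(d',d_0',u')$ with $d'>0$, then $(\mathsf{FP}_1)$ is unbounded. (b) $(\mathsf{FP}_2)$ has an optimal solution if and only if the trade-off condition holds. In this case, for an optimal solution $(d^*,d_0^*,u^* )$ of $(\mathsf{FP}_2)$: (i) if $d^*>0$, then $(d^*,x^* )$ with $x^*_{jkt}=u^*_{jkt}/d^*_{jt}$ for every $j\in\mathcal J$, $t\in\{0,\dots,T\}$, $k\in\mathcal K_{jt}$ is an optimal solution of $(\mathsf{FP}_1)$; (ii) if $d^*_{jt}=0$ for some $j\in\mathcal J$ and $t\in\{0,\dots,T\}$, then $(\mathsf{FP}_1)$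 is infeasible.
   Context: $T\ge0$ is an integer; $\mathcal J$ is a finite nonempty set (products), $\mathcal R$ a finite set (resources). For each $j\in\mathcal J$ and $t\in\{0,\dots,T\}$, $\mathcal K_{jt}$ is a finite nonempty set (attributes); these sets may overlap for different $j$. $\underline{\mathcal K}_{jt}\subseteq\mathcal K_{jt}$ is the set of attributes with a lower bound $\underline x_{jkt}\in\mathbb R$, $\overline{\mathcal K}_{jt}\subseteq\mathcal K_{jt}$ the set of attributes with an upper bound $\overline x_{jkt}\in\mathbb R$, and $\underline x_{jkt}\le\overline x_{jkt}$ for $k\in\underline{\mathcal K}_{jt}\cap\overline{\mathcal K}_{jt}$. $\overline{\mathcal J}_t:=\{j\in\mathcal J:\overline{\mathcal K}_{jt}=\mathcal K_{jt}\}$. Parameters: $\lambda_t>0$ (expected number of arrivals in period $t$), $\phi_{kt}>0$, and $\psi_{jt},a_{rj},b_r\in\mathbb R$. A vector is $>0$ if all components are positive. A maximization problem is "unbounded" if it is feasible and its objective is not bounded above on the feasible set. The exponential cone is $$\mathcal K_{\exp}:=\{(a_1,a_2,a_3): a_3\le a_2\ln(a_1/a_2),\ a_1>0,\ a_2>0\}\cup\{(a_1,0,a_3): a_1\ge0,\ a_3\le0\}\subset\mathbb R^3.$$ $(\mathsf{FP}_1)$, in the real variables $d=(d_{jt})$, $x=(x_{jkt})$: $$\max_{d,x}\ \sum_{t=0}^T\lambda_t\sum_{j\in\mathcal J}\Big(\sum_{k\in\mathcal K_{jt}}\phi_{kt}x_{jkt}-\psi_{jt}\Big)d_{jt}$$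 subject to $$d_{jt}=\frac{\exp(-\sum_{k\in\mathcal K_{jt}}x_{jkt})}{1+\sum_{j'\in\mathcal J}\exp(-\sum_{k\in\mathcal K_{j't}}x_{j'kt})}\quad\forall j\in\mathcal J,\ t=0,\dots,T;$$ $\sum_{t=0}^T\lambda_t\sum_{j\in\mathcal J}a_{rj}d_{jt}\le b_r$ for all $r\in\mathcal R$; $x_{jkt}\ge\underline x_{jkt}$ for all $j,t$ and $k\in\underline{\mathcal K}_{jt}$; $x_{jkt}\le\overline x_{jkt}$ for all $j,t$ and $k\in\overline{\mathcal K}_{jt}$. $(\mathsf{FP}_2)$, in the real variables $d=(d_{jt})$, $d_0=(d_{0t})$, $u=(u_{jkt})$: $$\max_{d,d_0,u}\ \sum_{t=0}^T\lambda_t\sum_{j\in\mathcal J}\Big(\sum_{k\in\mathcal K_{jt}}\phi_{kt}u_{jkt}-\psi_{jt}d_{jt}\Big)$$ subject to $\sum_{t=0}^T\lambda_t\sum_{j\in\mathcal J}a_{rj}d_{jt}\le b_r$ for all $r\in\mathcal R$; and, for all $t\in\{0,\dots,T\}$: $(d_{0t},d_{jt},\sum_{k\in\mathcal K_{jt}}u_{jkt})\in\mathcal K_{\exp}$ for all $j\in\mathcal J$; $(d_{jt},d_{0t},-\sum_{k\in\mathcal K_{jt}}\overline x_{jkt}d_{0t})\in\mathcal K_{\exp}$ for all $j\in\overline{\mathcal J}_t$; $u_{jkt}\ge\underline x_{jkt}d_{jt}$ for all $j\in\mathcal J$, $k\in\underline{\mathcal K}_{jt}$; $u_{jkt}\le\overline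 x_{jkt}d_{jt}$ for all $j\in\mathcal J$, $k\in\overline{\mathcal K}_{jt}$; $d_{0t}+\sum_{j\in\mathcal J}d_{jt}=1$. *)

theory Defs
  imports "HOL-Analysis.Analysis"
begin

record 'z max_problem =
  feasible_set :: "'z set"
  objective :: "'z \<Rightarrow> real"

definition feasible :: "'z max_problem \<Rightarrow> bool" where
  "feasible M \<longleftrightarrow> feasible_set M \<noteq> {}"

definition unbounded :: "'z max_problem \<Rightarrow> bool" where
  "unbounded M \<longleftrightarrow> feasible M \<and> \<not> bdd_above (objective M ` feasible_set M)"

definition optimal_solution :: "'z max_problem \<Rightarrow> 'z \<Rightarrow> bool" where
  "optimal_solution M z \<longleftrightarrow> is_arg_max (objective M) (\<lambda>y. y \<in> feasible_set M) z"

definition exp_cone :: "(real \<times> real \<times> real) set" where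
  "exp_cone =
     {(a1, a2, a3) | a1 a2 a3. a3 \<le> a2 * ln (a1 / a2) \<and> a1 > 0 \<and> a2 > 0} \<union>
     {(a1, 0, a3) | a1 a3. a1 \<ge> 0 \<and> a3 \<le> 0}"

text \<open>
  Periods are the natural numbers \<open>t \<le> horizon P\<close>. Indices are written in the order
  \<open>d j t\<close>, \<open>x j k t\<close>, \<open>\<phi> k t\<close>, \<open>\<psi> j t\<close>, \<open>a r j\<close>.
  The values \<open>lower P j k t\<close> and \<open>upper P j k t\<close> are only meaningful for
  \<open>k \<in> attrs_lb P j t\<close> and \<open>k \<in> attrs_ub P j t\<close>, respectively.
\<close>

record ('j, 'k, 'r) fluid_data =
  horizon :: nat
  products :: "'j set"
  resources :: "'r set"
  attrs :: "'j \<Rightarrow> nat \<Rightarrow> 'k set"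
  attrs_lb :: "'j \<Rightarrow> nat \<Rightarrow> 'k set"
  attrs_ub :: "'j \<Rightarrow> nat \<Rightarrow> 'k set"
  lower :: "'j \<Rightarrow> 'k \<Rightarrow> nat \<Rightarrow> real"
  upper :: "'j \<Rightarrow> 'k \<Rightarrow> nat \<Rightarrow> real"
  arrivals :: "nat \<Rightarrow> real"                \<comment> \<open>\<open>\<lambda>\<^sub>t\<close>\<close>
  phi :: "'k \<Rightarrow> nat \<Rightarrow> real"
  psi :: "'j \<Rightarrow> nat \<Rightarrow> real"
  consumption :: "'r \<Rightarrow> 'j \<Rightarrow> real"       \<comment> \<open>\<open>a\<^sub>r\<^sub>j\<close>\<close>
  capacity :: "'r \<Rightarrow> real"                \<comment> \<open>\<open>b\<^sub>r\<close>\<close>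

definition valid_fluid_data :: "('j, 'k, 'r) fluid_data \<Rightarrow> bool" where
  "valid_fluid_data P \<longleftrightarrow>
     finite (products P) \<and> products P \<noteq> {} \<and> finite (resources P) \<and>
     (\<forall>t\<le>horizon P. arrivals P t > 0) \<and>
     (\<forall>j\<in>products P. \<forall>t\<le>horizon P.
        finite (attrs P j t) \<and> attrs P j t \<noteq> {} \<and>
        attrs_lb P j t \<subseteq> attrs P j t \<and> attrs_ub P j t \<subseteq> attrs P j t \<and>
        (\<forall>k\<in>attrs_lb P j t \<inter> attrs_ub P j t. lower P j k t \<le> upper P j k t) \<and>
        (\<forall>k\<in>attrs P j t. phi P k t > 0))"

definition fully_upper_bounded :: "('j, 'k, 'r) fluid_data \<Rightarrow> nat \<Rightarrow> 'j set" where
  "fully_upper_bounded P t = {j \<in> products P. attrs_ub P j t = attrs P j t}"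

definition trade_off :: "('j, 'k, 'r) fluid_data \<Rightarrow> bool" where
  "trade_off P \<longleftrightarrow>
     (\<forall>j\<in>products P. \<forall>t\<le>horizon P.
        \<forall>k1\<in>attrs P j t - attrs_ub P j t. \<forall>k2\<in>attrs P j t - attrs_lb P j t.
          phi P k1 t \<le> phi P k2 t)"

definition positive_demand :: "('j, 'k, 'r) fluid_data \<Rightarrow> ('j \<Rightarrow> nat \<Rightarrow> real) \<Rightarrow> bool" where
  "positive_demand P d \<longleftrightarrow> (\<forall>j\<in>products P. \<forall>t\<le>horizon P. d j t > 0)"

definition resource_constraints ::
    "('j, 'k, 'r) fluid_data \<Rightarrow> ('j \<Rightarrow> nat \<Rightarrow> real) \<Rightarrow> bool" where
  "resource_constraints P d \<longleftrightarrow>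
     (\<forall>r\<in>resources P.
        (\<Sum>t\<le>horizon P. arrivals P t * (\<Sum>j\<in>products P. consumption P r j * d j t))
          \<le> capacity P r)"

text \<open>
  Decision vectors are total functions. Their values outside the index sets are unconstrained
  and occur neither in the constraints nor in the objective.
\<close>

definition FP1 ::
    "('j, 'k, 'r) fluid_data \<Rightarrow>
     (('j \<Rightarrow> nat \<Rightarrow> real) \<times> ('j \<Rightarrow> 'k \<Rightarrow> nat \<Rightarrow> real)) max_problem" where
  "FP1 P = \<lparr>
     feasible_set = {(d, x).
       (\<forall>j\<in>products P. \<forall>t\<le>horizon P.
          d j t = exp (- (\<Sum>k\<in>attrs P j t. x j k t)) /
                  (1 + (\<Sum>j'\<in>products P. exp (- (\<Sum>k\<in>attrs P j' t. x j' k t))))) \<and>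
       resource_constraints P d \<and>
       (\<forall>j\<in>products P. \<forall>t\<le>horizon P. \<forall>k\<in>attrs_lb P j t. x j k t \<ge> lower P j k t) \<and>
       (\<forall>j\<in>products P. \<forall>t\<le>horizon P. \<forall>k\<in>attrs_ub P j t. x j k t \<le> upper P j k t)},
     objective = (\<lambda>(d, x).
       \<Sum>t\<le>horizon P. arrivals P t *
         (\<Sum>j\<in>products P. ((\<Sum>k\<in>attrs P j t. phi P k t * x j k t) - psi P j t) * d j t))
   \<rparr>"

definition FP2 ::
    "('j, 'k, 'r) fluid_data \<Rightarrow>
     (('j \<Rightarrow> nat \<Rightarrow> real) \<times> (nat \<Rightarrow> real) \<times> ('j \<Rightarrow> 'k \<Rightarrow> nat \<Rightarrow> real)) max_problem" where
  "FP2 P = \<lparr>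
     feasible_set = {(d, d0, u).
       resource_constraints P d \<and>
       (\<forall>t\<le>horizon P.
          (\<forall>j\<in>products P. (d0 t, d j t, \<Sum>k\<in>attrs P j t. u j k t) \<in> exp_cone) \<and>
          (\<forall>j\<in>fully_upper_bounded P t.
             (d j t, d0 t, - (\<Sum>k\<in>attrs P j t. upper P j k t * d0 t)) \<in> exp_cone) \<and>
          (\<forall>j\<in>products P. \<forall>k\<in>attrs_lb P j t. u j k t \<ge> lower P j k t * d j t) \<and>
          (\<forall>j\<in>products P. \<forall>k\<in>attrs_ub P j t. u j k t \<le> upper P j k t * d j t) \<and>
          d0 t + (\<Sum>j\<in>products P. d j t) = 1)},
     objective = (\<lambda>(d, d0, u).
       \<Sum>t\<le>horizon P. arrivals P t *
         (\<Sum>j\<in>products P. (\<Sum>k\<in>attrs P j t. phi P k t * u j k t) - psi P j t * d j t))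
   \<rparr>"

end

theory Submission
  imports Defs
begin

text \<open>
  With $u_{jkt} = x_{jkt} d_{jt}$ and $d_{0t}$ the probability that a customer buys nothing, the
  logit equation says $\sum_k u_{jkt} = d_{jt} \ln (d_{0t} / d_{jt})$, whereas membership in the
  exponential cone says only that the left side is at most the right side. Hence a feasible point
  of the first problem gives a feasible point of the second with positive demand and the same
  value (\<open>FP1_feasible_imp_FP2_feasible\<close>). Conversely, at positive demand the
  slack can be removed by increasing some $u_{jkt}$: a product with an attribute without upper
  bound has room for that, and for any other product the second family of cone constraints says
  precisely that setting all its attributes to their upper bounds is enough
  (\<open>raise_to_tight\<close>). Since the weights $\phi$ are positive, this
  never lowers the objective, so on points of positive demand the relaxation is exact.

  It remains to decide when the relaxation is unbounded and what demand zero means.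

  If the trade-off condition fails at $k_1, k_2$, moving an amount $s$ from $u_{k_2}$ to
  $u_{k_1}$ leaves the sum and all bounds intact and earns a multiple of $s$, whatever the demand
  (\<open>FP2_not_trade_off_dominates\<close>).

  If the trade-off condition holds, a threshold $\theta \ge 0$ separates the weights: every
  attribute of weight above $\theta$ has an upper bound and every attribute of weight below
  $\theta$ has a lower bound. So in
  $\sum_k \phi_k u_k = \theta \sum_k u_k + \sum_k (\phi_k - \theta) u_k$
  every term is bounded above, and at points whose value is not too small also below. Only the
  distribution of mass among the attributes of weight exactly $\theta$ can be unbounded; it does
  not affect the objective and can be replaced by a bounded one. Thus a compact
  part of the closed feasible set suffices for the maximum (\<open>FP2_optimal_exists\<close>).

  Finally, suppose an optimum has $d_{jt} = 0$ although the first problem is feasible. Mixing in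
  a weight $\varepsilon$ of a point of positive demand changes the objective by
  $O(\varepsilon)$, but the entropy term opens up a slack of order
  $\varepsilon \ln (1 / \varepsilon)$, which an attribute without upper bound converts into a
  larger gain (\<open>FP2_optimal_zero_imp_FP1_infeasible\<close>).
\<close>

section \<open>The exponential cone\<close>

lemma exp_cone_pos_iff:
  assumes "a2 > 0"
  shows "(a1, a2, a3) \<in> exp_cone \<longleftrightarrow> a1 > 0 \<and> a3 \<le> a2 * ln (a1 / a2)"
  using assms by (auto simp: exp_cone_def)

lemma exp_cone_zero_iff: "(a1, 0, a3) \<in> exp_cone \<longleftrightarrow> a1 \<ge> 0 \<and> a3 \<le> 0"
  by (auto simp: exp_cone_def)

text \<open>
  The concave function $a_1 \mapsto a_2 \ln (a_1 / a_2)$ is the infimum of its tangents; $y$ is the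
  slope, so the tangent with $y = a_2 / a_1$ is the active one. For $a_2 = 0$ the inequalities read
  $a_3 \le y a_1$ for all $y > 0$, that is $a_1 \ge 0$ and $a_3 \le 0$. So a single family of linear
  inequalities describes both pieces of the cone, which yields convexity and closedness
  without a separate treatment of the boundary.
\<close>

lemma exp_cone_iff_tangents:
  "(a1, a2, a3) \<in> exp_cone \<longleftrightarrow> a2 \<ge> 0 \<and> (\<forall>y>0. a3 \<le> y * a1 - a2 * (1 + ln y))"
proof (cases "a2 > 0")
  case True
  show ?thesis
  proof (intro iffI conjI allI impI)
    fix y :: real
    assume "(a1, a2, a3) \<in> exp_cone" and y: "y > 0"
    then have a1: "a1 > 0" and a3: "a3 \<le> a2 * ln (a1 / a2)"
      using True by (auto simp: exp_cone_pos_iff)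
    have "ln (a1 / a2) + ln y = ln (a1 / a2 * y)"
      using a1 True y ln_mult[of "a1 / a2" y] by simp
    also have "\<dots> \<le> a1 / a2 * y - 1"
      using a1 True y by (intro ln_le_minus_one) simp
    finally have "a2 * (ln (a1 / a2) + ln y) \<le> a2 * (a1 / a2 * y - 1)"
      using True by (simp add: mult_left_mono)
    then show "a3 \<le> y * a1 - a2 * (1 + ln y)"
      using a3 True by (simp add: algebra_simps)
  next
    assume *: "a2 \<ge> 0 \<and> (\<forall>y>0. a3 \<le> y * a1 - a2 * (1 + ln y))"
    have a1: "a1 > 0"
    proof (rule ccontr)
      assume "\<not> a1 > 0"
      \<comment> \<open>For \<open>a1 \<le> 0\<close> the right side tends to minus infinity with the slope; this slope suffices.\<close>
      have "a3 \<le> exp (\<bar>a3\<bar> / a2) * a1 - a2 * (1 + \<bar>a3\<bar> / a2)"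
        using * by (metis exp_gt_zero ln_exp)
      also have "\<dots> \<le> - a2 - \<bar>a3\<bar>"
        using True \<open>\<not> a1 > 0\<close> mult_nonneg_nonpos[of "exp (\<bar>a3\<bar> / a2)" a1]
        by (simp add: algebra_simps)
      finally show False using True by linarith
    qed
    have "a3 \<le> (a2 / a1) * a1 - a2 * (1 + ln (a2 / a1))"
      using *[THEN conjunct2, rule_format, of "a2 / a1"] a1 True by simp
    also have "\<dots> = a2 * ln (a1 / a2)"
      using a1 True by (simp add: ln_div algebra_simps)
    finally show "(a1, a2, a3) \<in> exp_cone"
      using a1 True by (simp add: exp_cone_pos_iff)
  qed (use True in simp)
next
  case False
  show ?thesis
  proof (cases "a2 = 0")
    case True
    show ?thesis unfolding True exp_cone_zero_iff
    proof (intro iffI conjI allI impI)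
      fix y :: real assume "a1 \<ge> 0 \<and> a3 \<le> 0" "y > 0"
      then show "a3 \<le> y * a1 - 0 * (1 + ln y)"
        by (smt (verit) mult_nonneg_nonneg mult_zero_left)
    next
      assume "(0::real) \<ge> 0 \<and> (\<forall>y>0. a3 \<le> y * a1 - 0 * (1 + ln y))"
      then have *: "a3 \<le> y * a1" if "y > 0" for y using that by auto
      show a1: "a1 \<ge> 0"
      proof (rule ccontr)
        assume "\<not> a1 \<ge> 0"
        then have "a3 \<le> (\<bar>a3\<bar> + 1) / (- a1) * a1"
          by (intro *) (simp add: divide_pos_neg)
        also have "\<dots> = - (\<bar>a3\<bar> + 1)" using \<open>\<not> a1 \<ge> 0\<close> by simp
        finally show False by linarith
      qed
      show "a3 \<le> 0"
      proof (rule ccontr)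
        assume "\<not> a3 \<le> 0"
        then have "a1 > 0" using *[of 1] by simp
        then show False
          using *[of "a3 / (2 * a1)"] \<open>\<not> a3 \<le> 0\<close> by simp
      qed
    qed simp
  next
    case a2: False
    then have "\<not> a2 \<ge> 0" using False by simp
    then show ?thesis by (auto simp: exp_cone_def)
  qed
qed

lemma exp_cone_combination:
  assumes "(a1, a2, a3) \<in> exp_cone" "(b1, b2, b3) \<in> exp_cone" "s \<ge> 0" "t \<ge> 0"
  shows "(s * a1 + t * b1, s * a2 + t * b2, s * a3 + t * b3) \<in> exp_cone"
  unfolding exp_cone_iff_tangents
proof (intro conjI allI impI)
  show "0 \<le> s * a2 + t * b2"
    using assms by (auto simp: exp_cone_iff_tangents)
  fix y :: real assume "y > 0"
  then have "s * a3 \<le> s * (y * a1 - a2 * (1 + ln y))" "t * b3 \<le> t * (y * b1 - b2 * (1 + ln y))"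
    using assms by (auto simp: exp_cone_iff_tangents mult_left_mono)
  then show "s * a3 + t * b3 \<le> y * (s * a1 + t * b1) - (s * a2 + t * b2) * (1 + ln y)"
    by (simp add: algebra_simps)
qed

lemma closed_exp_cone_constraint:
  fixes f g h :: "'a::topological_space \<Rightarrow> real"
  assumes "continuous_on UNIV f" "continuous_on UNIV g" "continuous_on UNIV h"
  shows "closed {z. (f z, g z, h z) \<in> exp_cone}"
  unfolding exp_cone_iff_tangents
  by (intro closed_Collect_conj closed_Collect_all closed_Collect_imp closed_Collect_le
      open_Collect_const continuous_intros assms)


section \<open>Entrywise description of the problems\<close>

definition attribute_feasible ::
    "('j, 'k, 'r) fluid_data \<Rightarrow> 'j \<Rightarrow> nat \<Rightarrow> real \<Rightarrow> real \<Rightarrow> ('k \<Rightarrow> real) \<Rightarrow> bool" where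
  "attribute_feasible P j t \<delta>0 \<delta> v \<longleftrightarrow>
     (\<delta>0, \<delta>, \<Sum>k\<in>attrs P j t. v k) \<in> exp_cone \<and>
     (\<forall>k\<in>attrs_lb P j t. lower P j k t * \<delta> \<le> v k) \<and>
     (\<forall>k\<in>attrs_ub P j t. v k \<le> upper P j k t * \<delta>)"

definition revenue ::
    "('j, 'k, 'r) fluid_data \<Rightarrow> 'j \<Rightarrow> nat \<Rightarrow> real \<Rightarrow> ('k \<Rightarrow> real) \<Rightarrow> real" where
  "revenue P j t \<delta> v = arrivals P t * ((\<Sum>k\<in>attrs P j t. phi P k t * v k) - psi P j t * \<delta>)"

lemma FP1_feasible_iff:
  "(d, x) \<in> feasible_set (FP1 P) \<longleftrightarrow>
     (\<forall>j\<in>products P. \<forall>t\<le>horizon P.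
        d j t = exp (- (\<Sum>k\<in>attrs P j t. x j k t)) /
                (1 + (\<Sum>j'\<in>products P. exp (- (\<Sum>k\<in>attrs P j' t. x j' k t))))) \<and>
     resource_constraints P d \<and>
     (\<forall>j\<in>products P. \<forall>t\<le>horizon P. \<forall>k\<in>attrs_lb P j t. x j k t \<ge> lower P j k t) \<and>
     (\<forall>j\<in>products P. \<forall>t\<le>horizon P. \<forall>k\<in>attrs_ub P j t. x j k t \<le> upper P j k t)"
  by (simp add: FP1_def)

lemma FP1_objective:
  "objective (FP1 P) (d, x) =
     (\<Sum>t\<le>horizon P. \<Sum>j\<in>products P. revenue P j t (d j t) (\<lambda>k. x j k t * d j t))"
  by (simp add: FP1_def revenue_def sum_distrib_left sum_distrib_right algebra_simps)

lemma FP2_feasible_iff: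
  "(d, d0, u) \<in> feasible_set (FP2 P) \<longleftrightarrow>
     resource_constraints P d \<and>
     (\<forall>t\<le>horizon P.
        (\<forall>j\<in>products P. attribute_feasible P j t (d0 t) (d j t) (\<lambda>k. u j k t)) \<and>
        (\<forall>j\<in>fully_upper_bounded P t.
           (d j t, d0 t, - (\<Sum>k\<in>attrs P j t. upper P j k t * d0 t)) \<in> exp_cone) \<and>
        d0 t + (\<Sum>j\<in>products P. d j t) = 1)"
  unfolding FP2_def attribute_feasible_def by auto

lemma FP2_objective:
  "objective (FP2 P) (d, d0, u) =
     (\<Sum>t\<le>horizon P. \<Sum>j\<in>products P. revenue P j t (d j t) (\<lambda>k. u j k t))"
  by (simp add: FP2_def revenue_def sum_distrib_left)

text \<open>
  Together with the feasibility counterpart below, this reduces every improvement argument except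
  the simultaneous raising of all entries to a single product and period.
\<close>

lemma FP2_objective_modify:
  assumes "valid_fluid_data P" "j \<in> products P" "t \<le> horizon P"
  shows "objective (FP2 P) (d, d0, \<lambda>j' k t'. if j' = j \<and> t' = t then v k else u j' k t') =
    objective (FP2 P) (d, d0, u) +
    arrivals P t * ((\<Sum>k\<in>attrs P j t. phi P k t * v k) - (\<Sum>k\<in>attrs P j t. phi P k t * u j k t))"
    (is "objective _ (_, _, ?u') = _ + ?D")
proof -
  have fin: "finite (products P)" using assms by (simp add: valid_fluid_data_def)
  have "revenue P j' t' (d j' t') (\<lambda>k. ?u' j' k t') =
        revenue P j' t' (d j' t') (\<lambda>k. u j' k t') + (if t' = t then if j' = j then ?D else 0 else 0)"
    for j' t'
    by (auto simp: revenue_def algebra_simps)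
  then have "objective (FP2 P) (d, d0, ?u') =
      (\<Sum>t'\<le>horizon P. \<Sum>j'\<in>products P. revenue P j' t' (d j' t') (\<lambda>k. u j' k t') +
         (if t' = t then if j' = j then ?D else 0 else 0))"
    unfolding FP2_objective by simp
  also have "\<dots> = objective (FP2 P) (d, d0, u) +
      (\<Sum>t'\<le>horizon P. if t' = t then \<Sum>j'\<in>products P. (if j' = j then ?D else 0) else 0)"
    unfolding FP2_objective sum.distrib
    by (intro arg_cong2[where f = "(+)"] refl sum.cong) auto
  also have "\<dots> = objective (FP2 P) (d, d0, u) + ?D"
    using assms fin by simp
  finally show ?thesis .
qed

lemma FP2_feasible_modify:
  assumes "(d, d0, u) \<in> feasible_set (FP2 P)"
    and "attribute_feasible P j t (d0 t) (d j t) v"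
  shows "(d, d0, \<lambda>j' k t'. if j' = j \<and> t' = t then v k else u j' k t') \<in> feasible_set (FP2 P)"
proof -
  have "(\<lambda>k. if j' = j \<and> t' = t then v k else u j' k t') = (if j' = j \<and> t' = t then v else (\<lambda>k. u j' k t'))" for j' t'
    by auto
  then show ?thesis using assms by (simp add: FP2_feasible_iff)
qed

lemma FP2_demand_nonneg:
  assumes "(d, d0, u) \<in> feasible_set (FP2 P)" "j \<in> products P" "t \<le> horizon P"
  shows "d j t \<ge> 0"
  using assms by (auto simp: FP2_feasible_iff attribute_feasible_def exp_cone_iff_tangents)

text \<open>
  Positive demand needs a positive first coordinate in the cone, so $d_{0t} = 0$ would force all
  demands to vanish, against the normalisation to total share 1.
\<close>

lemma FP2_outside_share_pos:
  assumes "valid_fluid_data P" "(d, d0, u) \<in> feasible_set (FP2 P)" "t \<le> horizon P"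
  shows "d0 t > 0"
proof (rule ccontr)
  assume "\<not> d0 t > 0"
  have cone: "(d0 t, d j t, \<Sum>k\<in>attrs P j t. u j k t) \<in> exp_cone" if "j \<in> products P" for j
    using assms that by (auto simp: FP2_feasible_iff attribute_feasible_def)
  then have "d j t = 0" if "j \<in> products P" for j
    using that FP2_demand_nonneg[OF assms(2) that assms(3)] \<open>\<not> d0 t > 0\<close> exp_cone_pos_iff
    by (metis less_eq_real_def)
  moreover have "d0 t + (\<Sum>j\<in>products P. d j t) = 1"
    using assms by (auto simp: FP2_feasible_iff)
  ultimately show False using \<open>\<not> d0 t > 0\<close> by simp
qed

lemma FP2_shares_le_1:
  assumes "valid_fluid_data P" "(d, d0, u) \<in> feasible_set (FP2 P)" "t \<le> horizon P"
  shows "d0 t \<le> 1" and "j \<in> products P \<Longrightarrow> d j t \<le> 1"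
proof -
  have fin: "finite (products P)" using assms by (auto simp: valid_fluid_data_def)
  have nn: "\<And>j. j \<in> products P \<Longrightarrow> d j t \<ge> 0" using FP2_demand_nonneg[OF assms(2) _ assms(3)] .
  have eq: "d0 t + (\<Sum>j\<in>products P. d j t) = 1"
    using assms by (auto simp: FP2_feasible_iff)
  show "d0 t \<le> 1" using eq sum_nonneg[of "products P" "\<lambda>j. d j t"] nn by simp
  show "d j t \<le> 1" if "j \<in> products P"
    using eq member_le_sum[OF that, of "\<lambda>j. d j t"] nn fin FP2_outside_share_pos[OF assms] by force
qed

text \<open>
  The second cone constraint is a positive lower bound on the demand of a fully upper bounded
  product, because $d_{0t} > 0$.
\<close>

lemma FP2_zero_demand_imp_free_attribute:
  assumes "valid_fluid_data P" "(d, d0, u) \<in> feasible_set (FP2 P)" "j \<in> products P" "t \<le> horizon P"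
    and "d j t = 0"
  shows "\<exists>k. k \<in> attrs P j t - attrs_ub P j t"
proof (rule ccontr)
  assume "\<not> ?thesis"
  then have "j \<in> fully_upper_bounded P t"
    using assms by (force simp: fully_upper_bounded_def valid_fluid_data_def)
  then have "(0, d0 t, - (\<Sum>k\<in>attrs P j t. upper P j k t * d0 t)) \<in> exp_cone"
    using assms by (force simp: FP2_feasible_iff)
  then show False
    using FP2_outside_share_pos[OF assms(1,2,4)] by (simp add: exp_cone_pos_iff)
qed

lemma FP2_feasible_combination:
  assumes "(d, d0, u) \<in> feasible_set (FP2 P)" "(d', d0', u') \<in> feasible_set (FP2 P)"
    and "0 \<le> s" "0 \<le> t" "s + t = 1"
  shows "(\<lambda>j \<tau>. s * d j \<tau> + t * d' j \<tau>, \<lambda>\<tau>. s * d0 \<tau> + t * d0' \<tau>,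
          \<lambda>j k \<tau>. s * u j k \<tau> + t * u' j k \<tau>) \<in> feasible_set (FP2 P)"
  unfolding FP2_feasible_iff attribute_feasible_def
proof (intro conjI allI impI ballI)
  have *: "resource_constraints P d" "resource_constraints P d'"
    using assms by (auto simp: FP2_feasible_iff)
  show "resource_constraints P (\<lambda>j \<tau>. s * d j \<tau> + t * d' j \<tau>)"
    unfolding resource_constraints_def
  proof
    fix r assume "r \<in> resources P"
    then have "s * (\<Sum>t\<le>horizon P. arrivals P t * (\<Sum>j\<in>products P. consumption P r j * d j t)) +
               t * (\<Sum>t\<le>horizon P. arrivals P t * (\<Sum>j\<in>products P. consumption P r j * d' j t))
               \<le> s * capacity P r + t * capacity P r"
      using * assms by (intro add_mono mult_left_mono) (auto simp: resource_constraints_def)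
    also have "\<dots> = capacity P r" using assms by (metis distrib_right mult_1)
    finally show "(\<Sum>\<tau>\<le>horizon P. arrivals P \<tau> *
        (\<Sum>j\<in>products P. consumption P r j * (s * d j \<tau> + t * d' j \<tau>))) \<le> capacity P r"
      by (simp add: sum_distrib_left sum.distrib algebra_simps)
  qed
next
  fix \<tau> j assume "\<tau> \<le> horizon P" "j \<in> products P"
  then show "(s * d0 \<tau> + t * d0' \<tau>, s * d j \<tau> + t * d' j \<tau>,
      \<Sum>k\<in>attrs P j \<tau>. s * u j k \<tau> + t * u' j k \<tau>) \<in> exp_cone"
    using assms exp_cone_combination[of "d0 \<tau>" "d j \<tau>" "\<Sum>k\<in>attrs P j \<tau>. u j k \<tau>"
        "d0' \<tau>" "d' j \<tau>" "\<Sum>k\<in>attrs P j \<tau>. u' j k \<tau>" s t]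
    by (auto simp: FP2_feasible_iff attribute_feasible_def sum.distrib sum_distrib_left)
next
  fix \<tau> j k assume "\<tau> \<le> horizon P" "j \<in> products P" "k \<in> attrs_lb P j \<tau>"
  then have "s * (lower P j k \<tau> * d j \<tau>) + t * (lower P j k \<tau> * d' j \<tau>) \<le> s * u j k \<tau> + t * u' j k \<tau>"
    using assms
    by (intro add_mono mult_left_mono) (auto simp: FP2_feasible_iff attribute_feasible_def)
  then show "lower P j k \<tau> * (s * d j \<tau> + t * d' j \<tau>) \<le> s * u j k \<tau> + t * u' j k \<tau>"
    by (simp add: algebra_simps)
next
  fix \<tau> j k assume "\<tau> \<le> horizon P" "j \<in> products P" "k \<in> attrs_ub P j \<tau>"
  then have "s * u j k \<tau> + t * u' j k \<tau> \<le> s * (upper P j k \<tau> * d j \<tau>) + t * (upper P j k \<tau> * d' j \<tau>)"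
    using assms
    by (intro add_mono mult_left_mono) (auto simp: FP2_feasible_iff attribute_feasible_def)
  then show "s * u j k \<tau> + t * u' j k \<tau> \<le> upper P j k \<tau> * (s * d j \<tau> + t * d' j \<tau>)"
    by (simp add: algebra_simps)
next
  fix \<tau> j assume "\<tau> \<le> horizon P" "j \<in> fully_upper_bounded P \<tau>"
  then show "(s * d j \<tau> + t * d' j \<tau>, s * d0 \<tau> + t * d0' \<tau>,
      - (\<Sum>k\<in>attrs P j \<tau>. upper P j k \<tau> * (s * d0 \<tau> + t * d0' \<tau>))) \<in> exp_cone"
    using assms exp_cone_combination[of "d j \<tau>" "d0 \<tau>" "- (\<Sum>k\<in>attrs P j \<tau>. upper P j k \<tau> * d0 \<tau>)"
        "d' j \<tau>" "d0' \<tau>" "- (\<Sum>k\<in>attrs P j \<tau>. upper P j k \<tau> * d0' \<tau>)" s t]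
    by (auto simp: FP2_feasible_iff sum.distrib sum_distrib_left algebra_simps)
next
  fix \<tau> assume "\<tau> \<le> horizon P"
  then have "d0 \<tau> + (\<Sum>j\<in>products P. d j \<tau>) = 1" "d0' \<tau> + (\<Sum>j\<in>products P. d' j \<tau>) = 1"
    using assms by (auto simp: FP2_feasible_iff)
  then have "s * (d0 \<tau> + (\<Sum>j\<in>products P. d j \<tau>)) + t * (d0' \<tau> + (\<Sum>j\<in>products P. d' j \<tau>)) = 1"
    using assms by simp
  then show "s * d0 \<tau> + t * d0' \<tau> + (\<Sum>j\<in>products P. s * d j \<tau> + t * d' j \<tau>) = 1"
    by (simp add: sum.distrib sum_distrib_left algebra_simps)
qed

lemma FP2_objective_combination:
  "objective (FP2 P) (\<lambda>j \<tau>. s * d j \<tau> + t * d' j \<tau>, \<lambda>\<tau>. s * d0 \<tau> + t * d0' \<tau>,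
          \<lambda>j k \<tau>. s * u j k \<tau> + t * u' j k \<tau>) =
   s * objective (FP2 P) (d, d0, u) + t * objective (FP2 P) (d', d0', u')"
  unfolding FP2_objective revenue_def
  by (simp add: sum_distrib_left sum.distrib sum_subtractf algebra_simps)

section \<open>Passing between the two problems\<close>

text \<open>
  The logit equation reads $d_{jt} = d_{0t} \exp (- \sum_k x_{jkt})$ with $d_{0t}$ the reciprocal
  of the denominator. The first cone constraint then holds with equality; the second
  one follows from $x_{jkt} \le \overline{x}_{jkt}$.
\<close>

lemma FP1_feasible_imp_FP2_feasible:
  assumes "valid_fluid_data P" "(d, x) \<in> feasible_set (FP1 P)"
  obtains d0 where "(d, d0, \<lambda>j k t. x j k t * d j t) \<in> feasible_set (FP2 P)"
    and "positive_demand P d"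
    and "objective (FP2 P) (d, d0, \<lambda>j k t. x j k t * d j t) = objective (FP1 P) (d, x)"
proof -
  define D where "D t = 1 + (\<Sum>j\<in>products P. exp (- (\<Sum>k\<in>attrs P j t. x j k t)))" for t
  define d0 where "d0 t = 1 / D t" for t
  have D: "D t > 0" for t
    unfolding D_def by (smt (verit) exp_gt_zero sum_nonneg)
  have d: "d j t = d0 t * exp (- (\<Sum>k\<in>attrs P j t. x j k t))" if "j \<in> products P" "t \<le> horizon P" for j t
    using assms that by (simp add: FP1_feasible_iff d0_def D_def)
  have d0: "d0 t > 0" for t using D by (simp add: d0_def)
  have pos: "positive_demand P d"
    unfolding positive_demand_def using d d0 by simp
  have sum1: "d0 t + (\<Sum>j\<in>products P. d j t) = 1" if "t \<le> horizon P" for t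
  proof -
    have "d0 t + (\<Sum>j\<in>products P. d j t) =
        d0 t * (1 + (\<Sum>j\<in>products P. exp (- (\<Sum>k\<in>attrs P j t. x j k t))))"
      using that by (simp add: d algebra_simps sum_distrib_left)
    also have "\<dots> = 1" using D[of t] by (simp add: d0_def D_def)
    finally show ?thesis .
  qed
  have att: "attribute_feasible P j t (d0 t) (d j t) (\<lambda>k. x j k t * d j t)"
    if "j \<in> products P" "t \<le> horizon P" for j t
  proof -
    have dp: "d j t > 0" using pos that by (simp add: positive_demand_def)
    have "d0 t / d j t = exp (\<Sum>k\<in>attrs P j t. x j k t)"
      using d[OF that] d0[of t] dp by (simp add: exp_minus field_simps)
    then have "(d0 t, d j t, \<Sum>k\<in>attrs P j t. x j k t * d j t) \<in> exp_cone"
      using dp d0 by (simp add: exp_cone_pos_iff sum_distrib_right[symmetric])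
    moreover have "lower P j k t \<le> x j k t" if "k \<in> attrs_lb P j t" for k
      using assms(2) \<open>j \<in> products P\<close> \<open>t \<le> horizon P\<close> that by (simp add: FP1_feasible_iff)
    moreover have "x j k t \<le> upper P j k t" if "k \<in> attrs_ub P j t" for k
      using assms(2) \<open>j \<in> products P\<close> \<open>t \<le> horizon P\<close> that by (simp add: FP1_feasible_iff)
    ultimately show ?thesis
      using dp unfolding attribute_feasible_def by simp
  qed
  have cone: "(d j t, d0 t, - (\<Sum>k\<in>attrs P j t. upper P j k t * d0 t)) \<in> exp_cone"
    if "j \<in> fully_upper_bounded P t" "t \<le> horizon P" for j t
  proof -
    have j: "j \<in> products P" "attrs_ub P j t = attrs P j t"
      using that by (auto simp: fully_upper_bounded_def)
    have "(\<Sum>k\<in>attrs P j t. x j k t) \<le> (\<Sum>k\<in>attrs P j t. upper P j k t)"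
      using assms j that by (intro sum_mono) (auto simp: FP1_feasible_iff)
    moreover have "ln (d j t / d0 t) = - (\<Sum>k\<in>attrs P j t. x j k t)"
      using d[OF j(1) that(2)] d0[of t] by simp
    ultimately have "- (\<Sum>k\<in>attrs P j t. upper P j k t) * d0 t \<le> ln (d j t / d0 t) * d0 t"
      using d0[of t] by (intro mult_right_mono) auto
    then show ?thesis
      using d0[of t] pos j that
      by (simp add: exp_cone_pos_iff positive_demand_def sum_distrib_left mult.commute)
  qed
  have "(d, d0, \<lambda>j k t. x j k t * d j t) \<in> feasible_set (FP2 P)"
    using att cone sum1 assms by (auto simp: FP2_feasible_iff FP1_feasible_iff)
  then show ?thesis using pos that by (simp add: FP1_objective FP2_objective)
qed

text \<open>
  Tightness gives $\exp (- \sum_k u_{jkt} / d_{jt}) = d_{jt} / d_{0t}$, and the normalisation of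
  the shares identifies the logit denominator as $1 / d_{0t}$.
\<close>

lemma FP2_tight_imp_FP1_feasible:
  assumes "valid_fluid_data P" "(d, d0, u) \<in> feasible_set (FP2 P)" "positive_demand P d"
    and tight: "\<And>j t. j \<in> products P \<Longrightarrow> t \<le> horizon P \<Longrightarrow>
      (\<Sum>k\<in>attrs P j t. u j k t) = d j t * ln (d0 t / d j t)"
  shows "(d, \<lambda>j k t. u j k t / d j t) \<in> feasible_set (FP1 P)"
    and "objective (FP1 P) (d, \<lambda>j k t. u j k t / d j t) = objective (FP2 P) (d, d0, u)"
proof -
  have dp: "d j t > 0" if "j \<in> products P" "t \<le> horizon P" for j t
    using assms that by (simp add: positive_demand_def)
  have d0: "d0 t > 0" if "t \<le> horizon P" for t using FP2_outside_share_pos[OF assms(1,2) that] .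
  have ratio: "exp (- (\<Sum>k\<in>attrs P j t. u j k t / d j t)) = d j t / d0 t"
    if "j \<in> products P" "t \<le> horizon P" for j t
  proof -
    have "(\<Sum>k\<in>attrs P j t. u j k t / d j t) = ln (d0 t / d j t)"
      using tight[OF that] dp[OF that] by (simp add: sum_divide_distrib[symmetric])
    then show ?thesis
      using dp[OF that] d0[OF that(2)] by (simp add: exp_minus)
  qed
  have "d j t = exp (- (\<Sum>k\<in>attrs P j t. u j k t / d j t)) /
                (1 + (\<Sum>j'\<in>products P. exp (- (\<Sum>k\<in>attrs P j' t. u j' k t / d j' t))))"
    if "j \<in> products P" "t \<le> horizon P" for j t
  proof -
    have "1 + (\<Sum>j'\<in>products P. exp (- (\<Sum>k\<in>attrs P j' t. u j' k t / d j' t))) =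
        1 + (\<Sum>j'\<in>products P. d j' t) / d0 t"
      using that by (simp add: ratio sum_divide_distrib)
    also have "\<dots> = (d0 t + (\<Sum>j'\<in>products P. d j' t)) / d0 t"
      using d0[OF that(2)] by (simp add: field_simps)
    also have "\<dots> = 1 / d0 t"
      using assms(2) that by (simp add: FP2_feasible_iff)
    finally show ?thesis using ratio[OF that] d0[OF that(2)] by simp
  qed
  moreover have "lower P j k t \<le> u j k t / d j t"
    if "j \<in> products P" "t \<le> horizon P" "k \<in> attrs_lb P j t" for j k t
    using assms(2) that dp[OF that(1,2)]
    by (auto simp: FP2_feasible_iff attribute_feasible_def pos_le_divide_eq)
  moreover have "u j k t / d j t \<le> upper P j k t"
    if "j \<in> products P" "t \<le> horizon P" "k \<in> attrs_ub P j t" for j k t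
    using assms(2) that dp[OF that(1,2)]
    by (auto simp: FP2_feasible_iff attribute_feasible_def pos_divide_le_eq)
  ultimately show "(d, \<lambda>j k t. u j k t / d j t) \<in> feasible_set (FP1 P)"
    using assms(2) by (auto simp: FP1_feasible_iff FP2_feasible_iff)
  show "objective (FP1 P) (d, \<lambda>j k t. u j k t / d j t) = objective (FP2 P) (d, d0, u)"
    unfolding FP1_objective FP2_objective revenue_def
    using dp by (intro sum.cong refl) (auto simp: less_imp_neq[symmetric])
qed

text \<open>
  If some attribute has no upper bound, it absorbs the whole slack. Otherwise all entries
  move towards their upper bounds along a segment; by the second cone constraint the end point
  has a sum at least the target, so the target is reached on the way.
\<close>

lemma raise_to_tight:
  assumes valid: "valid_fluid_data P" and feas: "(d, d0, u) \<in> feasible_set (FP2 P)"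
    and jt: "j \<in> products P" "t \<le> horizon P" and dp: "d j t > 0"
  obtains v where "attribute_feasible P j t (d0 t) (d j t) v"
    and "\<And>k. k \<in> attrs P j t \<Longrightarrow> u j k t \<le> v k"
    and "(\<Sum>k\<in>attrs P j t. v k) = d j t * ln (d0 t / d j t)"
proof -
  define c where "c = d j t * ln (d0 t / d j t)"
  define U where "U = (\<Sum>k\<in>attrs P j t. u j k t)"
  have d0: "d0 t > 0" using FP2_outside_share_pos[OF valid feas jt(2)] .
  have fin: "finite (attrs P j t)" using valid jt by (simp add: valid_fluid_data_def)
  have af: "attribute_feasible P j t (d0 t) (d j t) (\<lambda>k. u j k t)"
    using feas jt by (simp add: FP2_feasible_iff)
  have Uc: "U \<le> c"
    using af dp by (simp add: attribute_feasible_def exp_cone_pos_iff c_def U_def)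
  have sub: "attrs_lb P j t \<subseteq> attrs P j t" "attrs_ub P j t \<subseteq> attrs P j t"
    using valid jt by (simp_all add: valid_fluid_data_def)
  have fin_v: "attribute_feasible P j t (d0 t) (d j t) v"
    if "\<And>k. k \<in> attrs P j t \<Longrightarrow> u j k t \<le> v k" "(\<Sum>k\<in>attrs P j t. v k) = c"
      "\<And>k. k \<in> attrs_ub P j t \<Longrightarrow> v k \<le> upper P j k t * d j t" for v
    using af that sub dp d0 unfolding attribute_feasible_def exp_cone_pos_iff[OF dp] c_def
    by (force intro: order_trans)
  show ?thesis
  proof (cases "\<exists>k. k \<in> attrs P j t - attrs_ub P j t")
    case True
    then obtain k0 where k0: "k0 \<in> attrs P j t" "k0 \<notin> attrs_ub P j t" by auto
    define v where "v = (\<lambda>k. u j k t + (if k = k0 then c - U else 0))"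
    have "(\<Sum>k\<in>attrs P j t. v k) = c"
      using k0 fin by (simp add: v_def sum.distrib U_def)
    moreover have "u j k t \<le> v k" for k using Uc by (simp add: v_def)
    moreover have "v k \<le> upper P j k t * d j t" if "k \<in> attrs_ub P j t" for k
      using that k0 af by (auto simp: v_def attribute_feasible_def)
    ultimately show ?thesis using fin_v that c_def by blast
  next
    case False
    then have ub: "attrs_ub P j t = attrs P j t" using sub by auto
    then have "j \<in> fully_upper_bounded P t" using jt by (simp add: fully_upper_bounded_def)
    then have "(d j t, d0 t, - (\<Sum>k\<in>attrs P j t. upper P j k t * d0 t)) \<in> exp_cone"
      using feas jt by (simp add: FP2_feasible_iff)
    then have "- (\<Sum>k\<in>attrs P j t. upper P j k t) * d0 t \<le> ln (d j t / d0 t) * d0 t"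
      using d0 by (simp add: exp_cone_pos_iff sum_distrib_left[symmetric] mult.commute)
    then have "- (\<Sum>k\<in>attrs P j t. upper P j k t) \<le> ln (d j t / d0 t)"
      using d0 by (simp only: mult_le_cancel_right_pos)
    then have "ln (d0 t / d j t) \<le> (\<Sum>k\<in>attrs P j t. upper P j k t)"
      using dp d0 by (simp add: ln_div)
    then have "c \<le> d j t * (\<Sum>k\<in>attrs P j t. upper P j k t)"
      unfolding c_def using dp by simp
    also have "\<dots> = (\<Sum>k\<in>attrs P j t. upper P j k t * d j t)"
      by (simp add: sum_distrib_left mult.commute)
    finally have cV: "c \<le> (\<Sum>k\<in>attrs P j t. upper P j k t * d j t)" (is "_ \<le> ?V") .
    have le: "u j k t \<le> upper P j k t * d j t" if "k \<in> attrs P j t" for k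
      using af that ub by (simp add: attribute_feasible_def)
    \<comment> \<open>If \<open>?V = U\<close> both equal \<open>c\<close> and the segment does not change the sum.\<close>
    define \<tau> where "\<tau> = (if ?V = U then 0 else (c - U) / (?V - U))"
    have \<tau>: "0 \<le> \<tau>" "\<tau> \<le> 1" "\<tau> * (?V - U) = c - U"
      using Uc cV by (auto simp: \<tau>_def field_simps)
    define v where "v = (\<lambda>k. u j k t + \<tau> * (upper P j k t * d j t - u j k t))"
    have "(\<Sum>k\<in>attrs P j t. v k) = U + \<tau> * (?V - U)"
      by (simp add: v_def sum.distrib U_def sum_distrib_left[symmetric] sum_subtractf)
    then have "(\<Sum>k\<in>attrs P j t. v k) = c" using \<tau> by simp
    moreover have "u j k t \<le> v k" if "k \<in> attrs P j t" for k
      using \<tau> le[OF that] by (simp add: v_def)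
    moreover have "v k \<le> upper P j k t * d j t" if "k \<in> attrs_ub P j t" for k
      using mult_left_le_one_le[of "upper P j k t * d j t - u j k t" \<tau>] \<tau> le[of k] that ub
      by (simp add: v_def)
    ultimately show ?thesis using fin_v that c_def by blast
  qed
qed

lemma FP2_positive_imp_FP1_dominates:
  assumes valid: "valid_fluid_data P" and feas: "(d, d0, u) \<in> feasible_set (FP2 P)"
    and pos: "positive_demand P d"
  obtains x where "(d, x) \<in> feasible_set (FP1 P)"
    and "objective (FP1 P) (d, x) \<ge> objective (FP2 P) (d, d0, u)"
proof -
  have "\<forall>j t. \<exists>v. j \<in> products P \<longrightarrow> t \<le> horizon P \<longrightarrow>
      attribute_feasible P j t (d0 t) (d j t) v \<and> (\<forall>k\<in>attrs P j t. u j k t \<le> v k) \<and>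
      (\<Sum>k\<in>attrs P j t. v k) = d j t * ln (d0 t / d j t)"
    using raise_to_tight[OF valid feas] pos by (metis positive_demand_def)
  then obtain v where v: "\<And>j t. j \<in> products P \<Longrightarrow> t \<le> horizon P \<Longrightarrow>
      attribute_feasible P j t (d0 t) (d j t) (v j t) \<and> (\<forall>k\<in>attrs P j t. u j k t \<le> v j t k) \<and>
      (\<Sum>k\<in>attrs P j t. v j t k) = d j t * ln (d0 t / d j t)"
    by metis
  have feas': "(d, d0, \<lambda>j k t. v j t k) \<in> feasible_set (FP2 P)"
    using feas v by (auto simp: FP2_feasible_iff)
  have "objective (FP2 P) (d, d0, \<lambda>j k t. v j t k) \<ge> objective (FP2 P) (d, d0, u)"
    unfolding FP2_objective revenue_def using valid v
    by (intro sum_mono mult_left_mono diff_mono order_refl)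
      (auto simp: valid_fluid_data_def less_imp_le)
  moreover have "(\<Sum>k\<in>attrs P j t. v j t k) = d j t * ln (d0 t / d j t)"
    if "j \<in> products P" "t \<le> horizon P" for j t
    using v that by blast
  note F = FP2_tight_imp_FP1_feasible[OF valid feas' pos this]
  ultimately show ?thesis using that[OF F(1)] F(2) by simp
qed

section \<open>Optimal and improving solutions of the relaxation\<close>

text \<open>
  Removing the slack raises entries with positive weight, so it may not change anything at an
  optimum.
\<close>

lemma FP2_optimal_imp_tight:
  assumes valid: "valid_fluid_data P" and opt: "optimal_solution (FP2 P) (d, d0, u)"
    and jt: "j \<in> products P" "t \<le> horizon P" and dp: "d j t > 0"
  shows "(\<Sum>k\<in>attrs P j t. u j k t) = d j t * ln (d0 t / d j t)"
proof -
  have feas: "(d, d0, u) \<in> feasible_set (FP2 P)"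
    using opt by (simp add: optimal_solution_def is_arg_max_def)
  obtain v where v: "attribute_feasible P j t (d0 t) (d j t) v"
    "\<And>k. k \<in> attrs P j t \<Longrightarrow> u j k t \<le> v k"
    "(\<Sum>k\<in>attrs P j t. v k) = d j t * ln (d0 t / d j t)"
    using raise_to_tight[OF valid feas jt dp] by metis
  have fin: "finite (attrs P j t)" and lam: "arrivals P t > 0" and phi: "\<And>k. k \<in> attrs P j t \<Longrightarrow> phi P k t > 0"
    using valid jt by (auto simp: valid_fluid_data_def)
  have "\<not> arrivals P t * ((\<Sum>k\<in>attrs P j t. phi P k t * v k) - (\<Sum>k\<in>attrs P j t. phi P k t * u j k t)) > 0"
    using FP2_feasible_modify[where v = v, OF feas v(1)] FP2_objective_modify[OF valid jt, of d d0 v u] opt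
    unfolding optimal_solution_def is_arg_max_def by fastforce
  then have "(\<Sum>k\<in>attrs P j t. phi P k t * v k) \<le> (\<Sum>k\<in>attrs P j t. phi P k t * u j k t)"
    using lam by (simp add: zero_less_mult_iff)
  then have "u j k t = v k" if "k \<in> attrs P j t" for k
  proof -
    have "\<not> u j k t < v k"
    proof
      assume "u j k t < v k"
      then have "(\<Sum>k\<in>attrs P j t. phi P k t * u j k t) < (\<Sum>k\<in>attrs P j t. phi P k t * v k)"
        using that fin v(2) phi by (intro sum_strict_mono_ex1) (auto simp: less_imp_le)
      then show False
        using \<open>(\<Sum>k\<in>attrs P j t. phi P k t * v k) \<le> _\<close> by simp
    qed
    then show ?thesis using v(2)[OF that] by simp
  qed
  then show ?thesis using v(3) by simp
qed

lemma FP2_optimal_positive_imp_FP1_optimal: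
  assumes valid: "valid_fluid_data P" and opt: "optimal_solution (FP2 P) (d, d0, u)"
    and pos: "positive_demand P d"
  shows "optimal_solution (FP1 P) (d, \<lambda>j k t. u j k t / d j t)"
proof -
  have feas: "(d, d0, u) \<in> feasible_set (FP2 P)"
    using opt by (simp add: optimal_solution_def is_arg_max_def)
  have tight: "\<And>j t. j \<in> products P \<Longrightarrow> t \<le> horizon P \<Longrightarrow>
      (\<Sum>k\<in>attrs P j t. u j k t) = d j t * ln (d0 t / d j t)"
    using FP2_optimal_imp_tight[OF valid opt] pos by (simp add: positive_demand_def)
  note F = FP2_tight_imp_FP1_feasible[OF valid feas pos tight]
  have "\<not> objective (FP1 P) y > objective (FP2 P) (d, d0, u)" if y: "y \<in> feasible_set (FP1 P)" for y
  proof (cases y)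
    case (Pair d' x')
    with y have "(d', x') \<in> feasible_set (FP1 P)" by simp
    then obtain d0' where
      "(d', d0', \<lambda>j k t. x' j k t * d' j t) \<in> feasible_set (FP2 P)" "positive_demand P d'"
      "objective (FP2 P) (d', d0', \<lambda>j k t. x' j k t * d' j t) = objective (FP1 P) (d', x')"
      by (rule FP1_feasible_imp_FP2_feasible[OF valid])
    then show ?thesis using opt Pair unfolding optimal_solution_def is_arg_max_def by fastforce
  qed
  then show ?thesis unfolding optimal_solution_def is_arg_max_def using F by simp
qed

text \<open>
  Mass moved from an attribute without lower bound to a heavier one without upper bound. The demand
  is untouched, so that the same lemma serves the first problem as well.
\<close>

lemma FP2_not_trade_off_dominates:
  assumes valid: "valid_fluid_data P" and feas: "(d, d0, u) \<in> feasible_set (FP2 P)"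
    and nt: "\<not> trade_off P"
  obtains u' where "(d, d0, u') \<in> feasible_set (FP2 P)" "objective (FP2 P) (d, d0, u') \<ge> N"
proof -
  obtain j t k1 k2 where jt: "j \<in> products P" "t \<le> horizon P"
    and k: "k1 \<in> attrs P j t" "k1 \<notin> attrs_ub P j t" "k2 \<in> attrs P j t" "k2 \<notin> attrs_lb P j t"
    and phi: "phi P k2 t < phi P k1 t"
    using nt unfolding trade_off_def by force
  have fin: "finite (attrs P j t)" and lam: "arrivals P t > 0"
    using valid jt by (auto simp: valid_fluid_data_def)
  define f where "f = objective (FP2 P) (d, d0, u)"
  define s where "s = \<bar>N - f\<bar> / (arrivals P t * (phi P k1 t - phi P k2 t))"
  have s: "s \<ge> 0" using lam phi by (simp add: s_def)
  define v where "v = (\<lambda>k. u j k t + ((if k = k1 then s else 0) - (if k = k2 then s else 0)))"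
  have sum_v: "(\<Sum>k\<in>attrs P j t. v k) = (\<Sum>k\<in>attrs P j t. u j k t)"
    using k fin by (simp add: v_def sum.distrib sum_subtractf)
  have "phi P i t * v i = phi P i t * u j i t +
      ((if i = k1 then phi P k1 t * s else 0) - (if i = k2 then phi P k2 t * s else 0))" for i
    by (simp add: v_def algebra_simps)
  then have "(\<Sum>k\<in>attrs P j t. phi P k t * v k) - (\<Sum>k\<in>attrs P j t. phi P k t * u j k t)
      = (phi P k1 t - phi P k2 t) * s"
    using k fin by (simp add: sum.distrib sum_subtractf left_diff_distrib)
  then have "objective (FP2 P) (d, d0, \<lambda>j' k t'. if j' = j \<and> t' = t then v k else u j' k t') =
      f + arrivals P t * ((phi P k1 t - phi P k2 t) * s)"
    using FP2_objective_modify[OF valid jt, of d d0 v u] by (simp add: f_def)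
  also have "arrivals P t * ((phi P k1 t - phi P k2 t) * s) = \<bar>N - f\<bar>"
    using lam phi by (simp add: s_def field_simps)
  finally have "objective (FP2 P) (d, d0, \<lambda>j' k t'. if j' = j \<and> t' = t then v k else u j' k t') \<ge> N"
    by simp
  moreover have "attribute_feasible P j t (d0 t) (d j t) v"
  proof -
    have af: "attribute_feasible P j t (d0 t) (d j t) (\<lambda>k. u j k t)"
      using feas jt by (simp add: FP2_feasible_iff)
    have "u j k t \<le> v k" if "k \<in> attrs_lb P j t" for k using that k s by (auto simp: v_def)
    moreover have "v k \<le> u j k t" if "k \<in> attrs_ub P j t" for k using that k s by (auto simp: v_def)
    ultimately show ?thesis using af sum_v unfolding attribute_feasible_def
      by (fastforce intro: order_trans)
  qed
  ultimately show ?thesis using that FP2_feasible_modify[OF feas] by blast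
qed

text \<open>
  The improving point is a mixture with weight $\varepsilon$ on a point of positive demand. Its
  demand at $(j, t)$ is $\varepsilon d'_{jt}$, for which the cone allows a sum $c$ of order
  $\varepsilon \ln (1 / \varepsilon)$, while the mixture itself uses only
  $W = O(\varepsilon)$. The attribute $k_0$ receives the difference.
\<close>

lemma FP2_optimal_zero_imp_FP1_infeasible:
  assumes valid: "valid_fluid_data P" and opt: "optimal_solution (FP2 P) (d, d0, u)"
    and jt: "j \<in> products P" "t \<le> horizon P" and zero: "d j t = 0"
  shows "\<not> feasible (FP1 P)"
proof
  assume "feasible (FP1 P)"
  then obtain d' x' where "(d', x') \<in> feasible_set (FP1 P)"
    by (auto simp: feasible_def)
  from FP1_feasible_imp_FP2_feasible[OF valid this] obtain d0' u' where
    feas': "(d', d0', u') \<in> feasible_set (FP2 P)" and pos: "positive_demand P d'" by blast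
  have feas: "(d, d0, u) \<in> feasible_set (FP2 P)"
    using opt by (simp add: optimal_solution_def is_arg_max_def)
  obtain k0 where k0: "k0 \<in> attrs P j t" "k0 \<notin> attrs_ub P j t"
    using FP2_zero_demand_imp_free_attribute[OF valid feas jt zero] by auto
  have fin: "finite (attrs P j t)" and lam: "arrivals P t > 0" and phi: "phi P k0 t > 0"
    using valid jt k0 by (auto simp: valid_fluid_data_def)
  have d0: "d0 t > 0" "d0' t > 0"
    using FP2_outside_share_pos[OF valid _ jt(2)] feas feas' by auto
  have dp: "d' j t > 0" using pos jt by (simp add: positive_demand_def)
  define G where "G = objective (FP2 P) (d, d0, u) - objective (FP2 P) (d', d0', u')"
  define U where "U = (\<Sum>k\<in>attrs P j t. u j k t)"
  define U' where "U' = (\<Sum>k\<in>attrs P j t. u' j k t)"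
  have U: "U \<le> 0"
  proof -
    have "(d0 t, d j t, U) \<in> exp_cone"
      using feas jt by (simp add: FP2_feasible_iff attribute_feasible_def U_def)
    then show ?thesis by (simp add: zero exp_cone_zero_iff)
  qed
  \<comment> \<open>Size of the logarithm for which the gain from the slack exceeds the loss \<open>\<epsilon> * G\<close> of mixing;
    the summand \<open>\<bar>U'\<bar>\<close> pays for the part \<open>W\<close> that the mixture already uses.\<close>
  define M where "M = (\<bar>G\<bar> / (arrivals P t * phi P k0 t) + \<bar>U'\<bar> + 1) / d' j t"
  have M: "M \<ge> 0" using lam phi dp by (simp add: M_def)
  \<comment> \<open>The second bound makes \<open>D0 / (\<epsilon> * d' j t) \<ge> exp M\<close>, given \<open>D0 \<ge> d0 t / 2\<close> from the first.\<close>
  define \<epsilon> where "\<epsilon> = min (1 / 2) (d0 t / (2 * d' j t) * exp (- M))"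
  have \<epsilon>: "0 < \<epsilon>" "\<epsilon> \<le> 1 / 2" "\<epsilon> \<le> d0 t / (2 * d' j t) * exp (- M)"
    using d0 dp by (auto simp: \<epsilon>_def)
  define D0 where "D0 = (1 - \<epsilon>) * d0 t + \<epsilon> * d0' t"
  define W where "W = (1 - \<epsilon>) * U + \<epsilon> * U'"
  define c where "c = \<epsilon> * d' j t * ln (D0 / (\<epsilon> * d' j t))"
  have D0: "D0 \<ge> d0 t / 2"
  proof -
    have "(1 / 2) * d0 t \<le> (1 - \<epsilon>) * d0 t" using \<epsilon> d0 by (intro mult_right_mono) auto
    then show ?thesis using \<epsilon> d0 by (simp add: D0_def add_increasing2)
  qed
  then have D0p: "D0 > 0" using d0 by simp
  have "exp M \<le> D0 / (\<epsilon> * d' j t)"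
  proof -
    have "exp M * (\<epsilon> * d' j t) \<le> exp M * (d0 t / (2 * d' j t) * exp (- M) * d' j t)"
      using \<epsilon>(3) dp by (intro mult_left_mono mult_right_mono) auto
    also have "\<dots> = d0 t / 2" using dp by (simp add: exp_minus field_simps)
    also have "\<dots> \<le> D0" using D0 .
    finally show ?thesis using \<epsilon> dp by (simp add: pos_le_divide_eq)
  qed
  then have "M \<le> ln (D0 / (\<epsilon> * d' j t))"
    using D0p \<epsilon> dp by (subst ln_ge_iff) auto
  then have "\<epsilon> * (d' j t * M) \<le> c"
    unfolding c_def using \<epsilon> dp by (simp add: mult.assoc)
  also have "d' j t * M = (\<bar>G\<bar> / (arrivals P t * phi P k0 t) + 1) + \<bar>U'\<bar>"
    using dp by (simp add: M_def)
  finally have "\<epsilon> * (\<bar>G\<bar> / (arrivals P t * phi P k0 t) + 1) + \<epsilon> * \<bar>U'\<bar> \<le> c"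
    by (simp only: distrib_left)
  moreover have "W \<le> \<epsilon> * \<bar>U'\<bar>"
    using mult_nonneg_nonpos[of "1 - \<epsilon>" U] mult_left_mono[of U' "\<bar>U'\<bar>" \<epsilon>] U \<epsilon>
    unfolding W_def by linarith
  ultimately have slack: "c - W \<ge> \<epsilon> * (\<bar>G\<bar> / (arrivals P t * phi P k0 t) + 1)"
    by linarith
  let ?d_mix = "\<lambda>j \<tau>. (1 - \<epsilon>) * d j \<tau> + \<epsilon> * d' j \<tau>"
  let ?outside_mix = "\<lambda>\<tau>. (1 - \<epsilon>) * d0 \<tau> + \<epsilon> * d0' \<tau>"
  let ?u_mix = "\<lambda>j k \<tau>. (1 - \<epsilon>) * u j k \<tau> + \<epsilon> * u' j k \<tau>"
  have feas_mix: "(?d_mix, ?outside_mix, ?u_mix) \<in> feasible_set (FP2 P)"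
    using FP2_feasible_combination[OF feas feas', where s = "1 - \<epsilon>" and t = \<epsilon>] \<epsilon> by simp
  have obj_mix: "objective (FP2 P) (?d_mix, ?outside_mix, ?u_mix) = objective (FP2 P) (d, d0, u) - \<epsilon> * G"
    unfolding FP2_objective_combination by (simp add: G_def algebra_simps)
  define v where "v = (\<lambda>k. ?u_mix j k t + (if k = k0 then c - W else 0))"
  have af: "attribute_feasible P j t (?outside_mix t) (?d_mix j t) (\<lambda>k. ?u_mix j k t)"
    using feas_mix jt unfolding FP2_feasible_iff by blast
  have dmix: "?d_mix j t = \<epsilon> * d' j t" using zero by simp
  have "(\<Sum>k\<in>attrs P j t. ?u_mix j k t) = W"
    by (simp add: W_def U_def U'_def sum.distrib sum_distrib_left)
  then have "(\<Sum>k\<in>attrs P j t. v k) = c"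
    using k0 fin by (simp add: v_def sum.distrib)
  then have cone: "(?outside_mix t, ?d_mix j t, \<Sum>k\<in>attrs P j t. v k) \<in> exp_cone"
    using D0p \<epsilon> dp unfolding dmix D0_def[symmetric] by (simp add: exp_cone_pos_iff c_def)
  have slack0: "c - W \<ge> 0"
  proof -
    have "0 \<le> \<epsilon> * (\<bar>G\<bar> / (arrivals P t * phi P k0 t) + 1)" using \<epsilon> lam phi by simp
    then show ?thesis using slack by linarith
  qed
  have "attribute_feasible P j t (?outside_mix t) (?d_mix j t) v"
    unfolding attribute_feasible_def
  proof (intro conjI ballI cone)
    fix k assume k: "k \<in> attrs_lb P j t"
    then show "lower P j k t * ?d_mix j t \<le> v k"
      using af slack0 unfolding attribute_feasible_def v_def by fastforce
  next
    fix k assume k: "k \<in> attrs_ub P j t"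
    then show "v k \<le> upper P j k t * ?d_mix j t"
      using af k0 unfolding attribute_feasible_def v_def by auto
  qed
  then have feas_v: "(?d_mix, ?outside_mix, \<lambda>j' k t'. if j' = j \<and> t' = t then v k else ?u_mix j' k t') \<in> feasible_set (FP2 P)"
    using FP2_feasible_modify[OF feas_mix] by blast
  have "phi P k t * v k = phi P k t * ?u_mix j k t + (if k = k0 then phi P k0 t * (c - W) else 0)" for k
    by (simp add: v_def algebra_simps)
  then have "(\<Sum>k\<in>attrs P j t. phi P k t * v k) - (\<Sum>k\<in>attrs P j t. phi P k t * ?u_mix j k t) = phi P k0 t * (c - W)"
    using k0 fin by (simp add: sum.distrib)
  then have "objective (FP2 P) (?d_mix, ?outside_mix, \<lambda>j' k t'. if j' = j \<and> t' = t then v k else ?u_mix j' k t') =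
      objective (FP2 P) (d, d0, u) - \<epsilon> * G + arrivals P t * (phi P k0 t * (c - W))"
    using FP2_objective_modify[OF valid jt, of ?d_mix ?outside_mix v ?u_mix] obj_mix by simp
  moreover have "arrivals P t * (phi P k0 t * (c - W)) > \<epsilon> * G"
  proof -
    have "\<epsilon> * G < \<epsilon> * (\<bar>G\<bar> + arrivals P t * phi P k0 t)"
      using \<epsilon>(1) mult_pos_pos[OF lam phi] by (intro mult_strict_left_mono) linarith+
    also have "\<dots> = arrivals P t * phi P k0 t * (\<epsilon> * (\<bar>G\<bar> / (arrivals P t * phi P k0 t) + 1))"
      using lam phi by (simp add: field_simps)
    also have "\<dots> \<le> arrivals P t * phi P k0 t * (c - W)"
      using slack lam phi by (intro mult_left_mono) auto
    finally show ?thesis by (simp add: mult.assoc)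
  qed
  ultimately show False
    using opt feas_v unfolding optimal_solution_def is_arg_max_def by force
qed



section \<open>Bounding the attribute variables\<close>

text \<open>
  \<open>L\<close> and \<open>U\<close> are the attributes with a lower and an upper bound. The largest weight without
  upper bound serves as \<open>\<theta>\<close>, and 0 if every attribute has an upper bound: the latter choice is
  valid because all weights are positive.
\<close>

lemma trade_off_threshold:
  fixes \<phi> :: "'k \<Rightarrow> real"
  assumes "finite K" "\<And>k. k \<in> K \<Longrightarrow> \<phi> k > 0"
    and "\<And>k1 k2. k1 \<in> K - U \<Longrightarrow> k2 \<in> K - L \<Longrightarrow> \<phi> k1 \<le> \<phi> k2"
  obtains \<theta> where "\<theta> \<ge> 0" "\<And>k. k \<in> K \<Longrightarrow> \<phi> k > \<theta> \<Longrightarrow> k \<in> U" "\<And>k. k \<in> K \<Longrightarrow> \<phi> k < \<theta> \<Longrightarrow> k \<in> L"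
proof (cases "K - U = {}")
  case True
  show ?thesis
    by (rule that[of 0]) (use True assms(2) in force)+
next
  case False
  define \<theta> where "\<theta> = Max (\<phi> ` (K - U))"
  have fin: "finite (\<phi> ` (K - U))" using assms(1) by simp
  have "\<theta> \<in> \<phi> ` (K - U)" unfolding \<theta>_def using False fin by (intro Max_in) auto
  then obtain k0 where k0: "k0 \<in> K - U" "\<theta> = \<phi> k0" by auto
  show ?thesis
  proof (rule that[of \<theta>])
    show "\<theta> \<ge> 0" using k0 assms(2)[of k0] by simp
    show "k \<in> U" if "k \<in> K" "\<phi> k > \<theta>" for k
    proof (rule ccontr)
      assume "k \<notin> U"
      then have "\<phi> k \<le> \<theta>" unfolding \<theta>_def using fin that by (intro Max_ge) auto
      then show False using that by simp
    qed
    show "k \<in> L" if "k \<in> K" "\<phi> k < \<theta>" for k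
      using assms(3)[OF k0(1), of k] that k0 by force
  qed
qed

text \<open>
  \<open>w\<close> goes from \<open>p\<close> towards \<open>u\<close> in the coordinates with \<open>u k > p k\<close> only, by a common fraction
  that produces the required sum. All steps have the same sign, so none exceeds the total
  excess, no matter how large the entries of \<open>u\<close> are.
\<close>

lemma redistribute_excess:
  fixes p u :: "'k \<Rightarrow> real"
  assumes "finite E" "sum p E \<le> sum u E"
  obtains w where "sum w E = sum u E" "\<And>k. k \<in> E \<Longrightarrow> p k \<le> w k"
    "\<And>k. k \<in> E \<Longrightarrow> w k \<le> max (p k) (u k)" "\<And>k. k \<in> E \<Longrightarrow> w k - p k \<le> sum u E - sum p E"
proof -
  define e where "e k = max 0 (u k - p k)" for k
  define S where "S = sum u E - sum p E"
  have S: "S \<ge> 0" using assms by (simp add: S_def)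
  have e: "e k \<ge> 0" for k by (simp add: e_def)
  have Se: "S \<le> sum e E"
    unfolding S_def sum_subtractf[symmetric] by (intro sum_mono) (simp add: e_def)
  define \<tau> where "\<tau> = (if sum e E = 0 then 0 else S / sum e E)"
  have \<tau>: "0 \<le> \<tau>" "\<tau> \<le> 1" "\<tau> * sum e E = S"
    using S Se by (auto simp: \<tau>_def divide_le_eq)
  define w where "w k = p k + \<tau> * e k" for k
  show ?thesis
  proof (rule that[of w])
    show "sum w E = sum u E"
      using \<tau>(3) by (simp add: w_def sum.distrib sum_distrib_left[symmetric] S_def)
    fix k assume k: "k \<in> E"
    show "p k \<le> w k" using \<tau> e[of k] by (simp add: w_def)
    have "\<tau> * e k \<le> e k" using \<tau> e[of k] by (simp add: mult_left_le_one_le)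
    then show "w k \<le> max (p k) (u k)" by (simp add: w_def e_def max_def split: if_splits)
    have "e k \<le> sum e E" using k e assms(1) by (intro member_le_sum) auto
    then have "\<tau> * e k \<le> S" using \<tau> by (metis mult_left_mono)
    then show "w k - p k \<le> sum u E - sum p E" by (simp add: w_def S_def)
  qed
qed

text \<open>
  The excess of \<open>u\<close> over \<open>p\<close> may have either sign; negating both vectors exchanges the two cases.
\<close>

lemma redistribute:
  fixes p u :: "'k \<Rightarrow> real"
  assumes "finite E"
  obtains w where "sum w E = sum u E" "\<And>k. k \<in> E \<Longrightarrow> min (p k) (u k) \<le> w k"
    "\<And>k. k \<in> E \<Longrightarrow> w k \<le> max (p k) (u k)" "\<And>k. k \<in> E \<Longrightarrow> \<bar>w k - p k\<bar> \<le> \<bar>sum u E - sum p E\<bar>"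
proof (cases "sum p E \<le> sum u E")
  case True
  from redistribute_excess[OF assms True] obtain w where w: "sum w E = sum u E" "\<And>k. k \<in> E \<Longrightarrow> p k \<le> w k"
    "\<And>k. k \<in> E \<Longrightarrow> w k \<le> max (p k) (u k)" "\<And>k. k \<in> E \<Longrightarrow> w k - p k \<le> sum u E - sum p E"
    by blast
  show ?thesis
    by (rule that[of w]) (use w in \<open>force simp: min_le_iff_disj\<close>)+
next
  case False
  then have "sum (\<lambda>k. - p k) E \<le> sum (\<lambda>k. - u k) E" by (simp add: sum_negf)
  from redistribute_excess[OF assms this] obtain w where w: "sum w E = sum (\<lambda>k. - u k) E"
    "\<And>k. k \<in> E \<Longrightarrow> - p k \<le> w k" "\<And>k. k \<in> E \<Longrightarrow> w k \<le> max (- p k) (- u k)"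
    "\<And>k. k \<in> E \<Longrightarrow> w k - (- p k) \<le> sum (\<lambda>k. - u k) E - sum (\<lambda>k. - p k) E"
    by blast
  show ?thesis
  proof (rule that[of "\<lambda>k. - w k"])
    show "(\<Sum>k\<in>E. - w k) = sum u E" using w(1) by (simp add: sum_negf)
    fix k assume k: "k \<in> E"
    show "min (p k) (u k) \<le> - w k" using w(3)[OF k] by (simp add: min_def max_def split: if_splits)
    show "- w k \<le> max (p k) (u k)" using w(2)[OF k] by (simp add: le_max_iff_disj)
    show "\<bar>- w k - p k\<bar> \<le> \<bar>sum u E - sum p E\<bar>"
      using w(2)[OF k] w(4)[OF k] by (simp add: sum_negf)
  qed
qed

lemma sum_lower_bound_imp_term_lower_bound:
  fixes g c :: "'i \<Rightarrow> real"
  assumes "finite I" "\<And>i. i \<in> I \<Longrightarrow> g i \<le> c i" "\<And>i. i \<in> I \<Longrightarrow> 0 \<le> c i" "i \<in> I"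
  shows "sum g I - sum c I \<le> g i"
proof -
  have "sum g I = g i + sum g (I - {i})" using assms by (simp add: sum.remove)
  also have "sum g (I - {i}) \<le> sum c (I - {i})" using assms by (intro sum_mono) auto
  also have "\<dots> \<le> sum c I" using assms by (intro sum_mono2) auto
  finally show ?thesis by simp
qed

lemma scaled_bound_le:
  fixes l h :: "'k \<Rightarrow> real"
  assumes fin: "finite K" and "0 \<le> \<delta>" "\<delta> \<le> 1" "k \<in> K"
  shows "\<bar>l k * \<delta>\<bar> \<le> (\<Sum>k\<in>K. \<bar>l k\<bar> + \<bar>h k\<bar>)" "\<bar>h k * \<delta>\<bar> \<le> (\<Sum>k\<in>K. \<bar>l k\<bar> + \<bar>h k\<bar>)"
proof -
  have "\<bar>l k\<bar> + \<bar>h k\<bar> \<le> (\<Sum>k\<in>K. \<bar>l k\<bar> + \<bar>h k\<bar>)"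
    using assms fin by (intro member_le_sum) auto
  moreover have "\<bar>l k * \<delta>\<bar> \<le> \<bar>l k\<bar>" "\<bar>h k * \<delta>\<bar> \<le> \<bar>h k\<bar>"
    using assms by (simp_all add: abs_mult mult_left_le)
  ultimately show "\<bar>l k * \<delta>\<bar> \<le> (\<Sum>k\<in>K. \<bar>l k\<bar> + \<bar>h k\<bar>)" "\<bar>h k * \<delta>\<bar> \<le> (\<Sum>k\<in>K. \<bar>l k\<bar> + \<bar>h k\<bar>)"
    by linarith+
qed

text \<open>
  The sign of \<open>\<phi> k - \<theta>\<close> selects the bound that is available.
\<close>

lemma weighted_terms_bounded_above:
  fixes \<phi> l h v :: "'k \<Rightarrow> real"
  assumes fin: "finite K"
    and \<theta>: "\<And>k. k \<in> K \<Longrightarrow> \<phi> k > \<theta> \<Longrightarrow> k \<in> U" "\<And>k. k \<in> K \<Longrightarrow> \<phi> k < \<theta> \<Longrightarrow> k \<in> L"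
    and \<delta>: "0 \<le> \<delta>" "\<delta> \<le> 1" and k: "k \<in> K"
    and v: "\<And>k. k \<in> L \<Longrightarrow> l k * \<delta> \<le> v k" "\<And>k. k \<in> U \<Longrightarrow> v k \<le> h k * \<delta>"
  shows "(\<phi> k - \<theta>) * v k \<le> \<bar>\<phi> k - \<theta>\<bar> * (\<Sum>k\<in>K. \<bar>l k\<bar> + \<bar>h k\<bar>)"
proof (cases "\<phi> k > \<theta>")
  case True
  then have "v k \<le> (\<Sum>k\<in>K. \<bar>l k\<bar> + \<bar>h k\<bar>)"
    using \<theta>(1)[OF k] v(2)[of k] scaled_bound_le(2)[OF fin \<delta> k, of h l] by simp
  then show ?thesis using True by (simp add: mult_left_mono)
next
  case False
  show ?thesis
  proof (cases "\<phi> k = \<theta>")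
    case neq: False
    then have "- v k \<le> (\<Sum>k\<in>K. \<bar>l k\<bar> + \<bar>h k\<bar>)"
      using False \<theta>(2)[OF k] v(1)[of k] scaled_bound_le(1)[OF fin \<delta> k, of l h] by simp
    then have "(\<theta> - \<phi> k) * - v k \<le> (\<theta> - \<phi> k) * (\<Sum>k\<in>K. \<bar>l k\<bar> + \<bar>h k\<bar>)"
      using False by (intro mult_left_mono) auto
    then show ?thesis using False by (simp add: abs_if algebra_simps)
  qed simp
qed

text \<open>
  Here \<open>\<delta>\<close> is the demand that scales the bounds, and the bound 1 on the sum is what the
  exponential cone implies for shares in the unit interval.
\<close>

lemma weighted_sum_bounded_above:
  fixes \<phi> l h :: "'k \<Rightarrow> real"
  assumes fin: "finite K" and pos: "\<And>k. k \<in> K \<Longrightarrow> \<phi> k > 0"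
    and trade: "\<And>k1 k2. k1 \<in> K - U \<Longrightarrow> k2 \<in> K - L \<Longrightarrow> \<phi> k1 \<le> \<phi> k2"
  shows "\<exists>C\<ge>0. \<forall>\<delta> v. 0 \<le> \<delta> \<longrightarrow> \<delta> \<le> 1 \<longrightarrow>
    (\<forall>k\<in>L. l k * \<delta> \<le> v k) \<and> (\<forall>k\<in>U. v k \<le> h k * \<delta>) \<longrightarrow> sum v K \<le> 1 \<longrightarrow>
    (\<Sum>k\<in>K. \<phi> k * v k) \<le> C"
proof -
  obtain \<theta> where \<theta>: "\<theta> \<ge> 0" "\<And>k. k \<in> K \<Longrightarrow> \<phi> k > \<theta> \<Longrightarrow> k \<in> U" "\<And>k. k \<in> K \<Longrightarrow> \<phi> k < \<theta> \<Longrightarrow> k \<in> L"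
    using trade_off_threshold[of K \<phi> U L] fin pos trade by blast
  define c where "c k = \<bar>\<phi> k - \<theta>\<bar> * (\<Sum>k\<in>K. \<bar>l k\<bar> + \<bar>h k\<bar>)" for k
  have c: "c k \<ge> 0" for k by (simp add: c_def sum_nonneg)
  show ?thesis
  proof (intro exI[of _ "\<theta> + sum c K"] conjI allI impI)
    show "0 \<le> \<theta> + sum c K" using \<theta> c by (simp add: sum_nonneg)
    fix \<delta> v assume "0 \<le> \<delta>" "\<delta> \<le> 1" "sum v K \<le> 1"
      and "(\<forall>k\<in>L. l k * \<delta> \<le> v k) \<and> (\<forall>k\<in>U. v k \<le> h k * \<delta>)"
    then have a: "0 \<le> \<delta>" "\<delta> \<le> 1" "\<And>k. k \<in> L \<Longrightarrow> l k * \<delta> \<le> v k"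
      "\<And>k. k \<in> U \<Longrightarrow> v k \<le> h k * \<delta>" "sum v K \<le> 1"
      by auto
    have "(\<Sum>k\<in>K. \<phi> k * v k) = \<theta> * sum v K + (\<Sum>k\<in>K. (\<phi> k - \<theta>) * v k)"
      by (simp add: sum_distrib_left sum.distrib[symmetric] algebra_simps)
    also have "(\<Sum>k\<in>K. (\<phi> k - \<theta>) * v k) \<le> sum c K"
      unfolding c_def using weighted_terms_bounded_above[OF fin \<theta>(2,3) a(1,2) _ a(3,4)]
      by (intro sum_mono) auto
    also have "\<theta> * sum v K \<le> \<theta>" using a(5) \<theta>(1) by (simp add: mult_left_le)
    finally show "(\<Sum>k\<in>K. \<phi> k * v k) \<le> \<theta> + sum c K" by simp
  qed
qed

text \<open>
  Since every term of $\theta \sum_k v_k + \sum_k (\phi_k - \theta) v_k$ is bounded above, a lower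
  bound \<open>A\<close> on the total bounds each term below. This controls the entries of weight
  different from \<open>\<theta>\<close> and, through the total, the sum over the remaining set \<open>E\<close>. Within \<open>E\<close> all
  weights coincide, so the mass may be redistributed near a bounded base point \<open>p\<close> of the box. If
  \<open>E\<close> is nonempty then \<open>\<theta>\<close> is a weight and hence positive, which the division by \<open>\<theta>\<close> requires.
\<close>

lemma bounded_representative:
  fixes \<phi> l h :: "'k \<Rightarrow> real"
  assumes fin: "finite K" and pos: "\<And>k. k \<in> K \<Longrightarrow> \<phi> k > 0"
    and trade: "\<And>k1 k2. k1 \<in> K - U \<Longrightarrow> k2 \<in> K - L \<Longrightarrow> \<phi> k1 \<le> \<phi> k2"
    and bounds: "\<And>k. k \<in> L \<inter> U \<Longrightarrow> l k \<le> h k"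
  shows "\<exists>B. \<forall>\<delta> v. 0 \<le> \<delta> \<longrightarrow> \<delta> \<le> 1 \<longrightarrow>
    (\<forall>k\<in>L. l k * \<delta> \<le> v k) \<and> (\<forall>k\<in>U. v k \<le> h k * \<delta>) \<longrightarrow> sum v K \<le> 1 \<longrightarrow>
    A \<le> (\<Sum>k\<in>K. \<phi> k * v k) \<longrightarrow>
    (\<exists>w. ((\<forall>k\<in>L. l k * \<delta> \<le> w k) \<and> (\<forall>k\<in>U. w k \<le> h k * \<delta>)) \<and> sum w K = sum v K \<and>
      (\<Sum>k\<in>K. \<phi> k * w k) = (\<Sum>k\<in>K. \<phi> k * v k) \<and> (\<forall>k\<in>K. \<bar>w k\<bar> \<le> B))"
proof -
  obtain \<theta> where \<theta>: "\<theta> \<ge> 0" "\<And>k. k \<in> K \<Longrightarrow> \<phi> k > \<theta> \<Longrightarrow> k \<in> U" "\<And>k. k \<in> K \<Longrightarrow> \<phi> k < \<theta> \<Longrightarrow> k \<in> L"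
    using trade_off_threshold[of K \<phi> U L] fin pos trade by blast
  define R where "R = (\<Sum>k\<in>K. \<bar>l k\<bar> + \<bar>h k\<bar>)"
  define c where "c k = \<bar>\<phi> k - \<theta>\<bar> * R" for k
  define A' where "A' = \<bar>A\<bar> + \<theta> + sum c K"
  \<comment> \<open>The terms of \<open>M\<close> with \<open>\<phi> k = \<theta>\<close> are 0 by convention; \<open>M\<close> bounds the entries outside \<open>E\<close>, \<open>S\<close> the sum over \<open>E\<close>.\<close>
  define M where "M = (\<Sum>k\<in>K. A' / \<bar>\<phi> k - \<theta>\<bar>)"
  define E where "E = {k \<in> K. \<phi> k = \<theta>}"
  define S where "S = 1 + A' / \<theta> + card K * M"
  define B where "B = M + R + S + card K * R"
  have R: "R \<ge> 0" by (simp add: R_def sum_nonneg)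
  have c: "c k \<ge> 0" for k using R by (simp add: c_def)
  have A': "A' \<ge> 0" "c k \<le> A'" if "k \<in> K" for k
    using \<theta>(1) c member_le_sum[OF that, of c] fin by (auto simp: A'_def sum_nonneg)
  have A'0: "A' \<ge> 0" using \<theta>(1) c by (simp add: A'_def sum_nonneg)
  have M: "M \<ge> 0" using A'0 by (simp add: M_def sum_nonneg)
  have S: "S \<ge> 0" using A'0 M \<theta>(1) by (simp add: S_def)
  have finE: "finite E" "E \<subseteq> K" using fin by (auto simp: E_def)
  show ?thesis
  proof (intro exI[of _ B] allI impI)
    fix \<delta> v assume "0 \<le> \<delta>" "\<delta> \<le> 1" "sum v K \<le> 1" "A \<le> (\<Sum>k\<in>K. \<phi> k * v k)"
      and "(\<forall>k\<in>L. l k * \<delta> \<le> v k) \<and> (\<forall>k\<in>U. v k \<le> h k * \<delta>)"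
    then have a: "0 \<le> \<delta>" "\<delta> \<le> 1" "\<And>k. k \<in> L \<Longrightarrow> l k * \<delta> \<le> v k"
      "\<And>k. k \<in> U \<Longrightarrow> v k \<le> h k * \<delta>" "sum v K \<le> 1" "A \<le> (\<Sum>k\<in>K. \<phi> k * v k)"
      by auto
    have x: "(\<phi> k - \<theta>) * v k \<le> c k" if "k \<in> K" for k
      unfolding c_def R_def using weighted_terms_bounded_above[OF fin \<theta>(2,3) a(1,2) that a(3,4)] .
    have split: "(\<Sum>k\<in>K. \<phi> k * v k) = \<theta> * sum v K + (\<Sum>k\<in>K. (\<phi> k - \<theta>) * v k)"
      by (simp add: sum_distrib_left sum.distrib[symmetric] algebra_simps)
    have sum1: "\<theta> * sum v K \<le> \<theta>" using a(5) \<theta>(1) by (simp add: mult_left_le)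
    have vM: "\<bar>v k\<bar> \<le> M" if k: "k \<in> K - E" for k
    proof -
      have ne: "\<phi> k \<noteq> \<theta>" using k by (simp add: E_def)
      have "(\<Sum>k\<in>K. (\<phi> k - \<theta>) * v k) - sum c K \<le> (\<phi> k - \<theta>) * v k"
        using x c fin k by (intro sum_lower_bound_imp_term_lower_bound) auto
      then have "- A' \<le> (\<phi> k - \<theta>) * v k"
        using split sum1 a(6) by (simp add: A'_def)
      then have "\<bar>(\<phi> k - \<theta>) * v k\<bar> \<le> A'"
        using x[of k] A'(2)[of k] k by auto
      then have "\<bar>v k\<bar> \<le> A' / \<bar>\<phi> k - \<theta>\<bar>"
        using ne by (simp add: abs_mult pos_le_divide_eq mult.commute)
      also have "\<dots> \<le> M"
        unfolding M_def using k fin A'0 by (intro member_le_sum) auto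
      finally show ?thesis .
    qed
    have vKE: "\<bar>sum v (K - E)\<bar> \<le> card K * M"
    proof -
      have "\<bar>sum v (K - E)\<bar> \<le> (\<Sum>k\<in>K - E. \<bar>v k\<bar>)" by (rule sum_abs)
      also have "\<dots> \<le> card (K - E) * M" using vM by (intro sum_bounded_above) auto
      also have "\<dots> \<le> card K * M" using M fin by (intro mult_right_mono) (auto intro: card_mono)
      finally show ?thesis .
    qed
    have splitE: "sum f K = sum f (K - E) + sum f E" for f :: "'k \<Rightarrow> real"
      using sum.subset_diff[OF finE(2) fin, of f] by simp
    have vE: "\<bar>sum v E\<bar> \<le> S" if "E \<noteq> {}"
    proof -
      obtain k where "k \<in> E" using \<open>E \<noteq> {}\<close> by auto
      then have \<theta>p: "\<theta> > 0" using pos[of k] by (auto simp: E_def)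
      have "(\<Sum>k\<in>K. (\<phi> k - \<theta>) * v k) \<le> sum c K" using x by (rule sum_mono)
      then have "- A' \<le> \<theta> * sum v K" using split a(6) \<theta>(1) by (simp add: A'_def)
      then have "- (A' / \<theta>) \<le> sum v K" using \<theta>p by (simp add: field_simps)
      moreover have "0 \<le> A' / \<theta>" using A'0 \<theta>p by simp
      ultimately show ?thesis
        using a(5) vKE splitE[of v] unfolding S_def by linarith
    qed
    define p where "p k = (if k \<in> L then l k * \<delta> else if k \<in> U then h k * \<delta> else 0)" for k
    have p: "l k * \<delta> \<le> p k" if "k \<in> L" for k using that by (simp add: p_def)
    have p': "p k \<le> h k * \<delta>" if "k \<in> U" for k
      using that bounds[of k] a(1) by (auto simp: p_def mult_right_mono)
    have pR: "\<bar>p k\<bar> \<le> R" if "k \<in> K" for k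
      using scaled_bound_le[OF fin a(1,2) that, of l h] scaled_bound_le[OF fin a(1,2) that, of h l] R by (auto simp: p_def R_def[symmetric])
    have pE: "\<bar>sum p E\<bar> \<le> card K * R"
    proof -
      have "\<bar>sum p E\<bar> \<le> (\<Sum>k\<in>E. \<bar>p k\<bar>)" by (rule sum_abs)
      also have "\<dots> \<le> card E * R" using pR finE by (intro sum_bounded_above) auto
      also have "\<dots> \<le> card K * R" using R fin finE by (intro mult_right_mono) (auto intro: card_mono)
      finally show ?thesis .
    qed
    obtain q where q: "sum q E = sum v E" "\<And>k. k \<in> E \<Longrightarrow> min (p k) (v k) \<le> q k"
      "\<And>k. k \<in> E \<Longrightarrow> q k \<le> max (p k) (v k)" "\<And>k. k \<in> E \<Longrightarrow> \<bar>q k - p k\<bar> \<le> \<bar>sum v E - sum p E\<bar>"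
      using redistribute[OF finE(1), of v p] by blast
    define w where "w k = (if k \<in> E then q k else v k)" for k
    have "sum w K = sum v (K - E) + sum q E"
      unfolding splitE[of w] by (intro arg_cong2[where f = "(+)"] sum.cong) (auto simp: w_def)
    then have sum_w: "sum w K = sum v K" using q(1) splitE[of v] by simp
    have "(\<Sum>k\<in>K. \<phi> k * w k) = (\<Sum>k\<in>K - E. \<phi> k * v k) + (\<Sum>k\<in>E. \<theta> * q k)"
      unfolding splitE[of "\<lambda>k. \<phi> k * w k"]
      by (intro arg_cong2[where f = "(+)"] sum.cong) (auto simp: w_def E_def)
    also have "(\<Sum>k\<in>E. \<theta> * q k) = (\<Sum>k\<in>E. \<theta> * v k)"
      using q(1) by (simp add: sum_distrib_left[symmetric])
    also have "\<dots> = (\<Sum>k\<in>E. \<phi> k * v k)" by (intro sum.cong) (auto simp: E_def)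
    finally have obj_w: "(\<Sum>k\<in>K. \<phi> k * w k) = (\<Sum>k\<in>K. \<phi> k * v k)"
      using splitE[of "\<lambda>k. \<phi> k * v k"] by simp
    have "l k * \<delta> \<le> w k" if "k \<in> L" for k
      using a(3)[OF that] p[OF that] q(2)[of k] by (auto simp: w_def min_def split: if_splits)
    moreover have "w k \<le> h k * \<delta>" if "k \<in> U" for k
      using a(4)[OF that] p'[OF that] q(3)[of k] by (auto simp: w_def max_def split: if_splits)
    moreover have "\<bar>w k\<bar> \<le> B" if "k \<in> K" for k
    proof (cases "k \<in> E")
      case True
      then have "\<bar>q k\<bar> \<le> R + (S + card K * R)"
        using q(4)[OF True] pR[OF that] vE pE by force
      then show ?thesis using M True by (simp add: w_def B_def)
    next
      case False
      then have "\<bar>w k\<bar> \<le> M" using vM that by (simp add: w_def)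
      moreover have "0 \<le> card K * R" using R by simp
      ultimately show ?thesis using R S unfolding B_def by linarith
    qed
    ultimately show "\<exists>w. ((\<forall>k\<in>L. l k * \<delta> \<le> w k) \<and> (\<forall>k\<in>U. w k \<le> h k * \<delta>)) \<and> sum w K = sum v K \<and>
        (\<Sum>k\<in>K. \<phi> k * w k) = (\<Sum>k\<in>K. \<phi> k * v k) \<and> (\<forall>k\<in>K. \<bar>w k\<bar> \<le> B)"
      using sum_w obj_w by blast
  qed
qed

section \<open>Existence of an optimal solution\<close>

text \<open>
  The cubes range over all arguments, also those outside the index sets; there a feasible point
  can be reset to 0. Compactness is then Tychonoff's theorem.
\<close>

definition coordinate_box :: "real \<Rightarrow> (('j \<Rightarrow> nat \<Rightarrow> real) \<times> (nat \<Rightarrow> real) \<times> ('j \<Rightarrow> 'k \<Rightarrow> nat \<Rightarrow> real)) set" where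
  "coordinate_box B = {d. \<forall>j. d j \<in> {g. \<forall>t. g t \<in> {-B..B}}} \<times> {g. \<forall>t. g t \<in> {-B..B}} \<times>
     {u. \<forall>j. u j \<in> {v. \<forall>k. v k \<in> {g. \<forall>t. g t \<in> {-B..B}}}}"

lemma compact_pointwise:
  fixes S :: "'i \<Rightarrow> 'a::topological_space set"
  assumes "\<And>i. compact (S i)"
  shows "compact {f. \<forall>i. f i \<in> S i}"
proof -
  have "compactin (product_topology (\<lambda>i. euclidean) UNIV) (PiE UNIV S)"
    using assms by (simp add: compactin_PiE)
  moreover have "PiE UNIV S = {f. \<forall>i. f i \<in> S i}" by auto
  ultimately show ?thesis by (simp add: euclidean_product_topology)
qed

lemma compact_coordinate_box: "compact (coordinate_box B)"
  unfolding coordinate_box_def by (intro compact_Times compact_pointwise compact_Icc)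

lemma FP2_coordinates_continuous:
  fixes i :: 'j and k :: 'k and t :: nat
  shows "continuous_on UNIV
      (\<lambda>z :: ('j \<Rightarrow> nat \<Rightarrow> real) \<times> (nat \<Rightarrow> real) \<times> ('j \<Rightarrow> 'k \<Rightarrow> nat \<Rightarrow> real). fst z i t)"
    and "continuous_on UNIV
      (\<lambda>z :: ('j \<Rightarrow> nat \<Rightarrow> real) \<times> (nat \<Rightarrow> real) \<times> ('j \<Rightarrow> 'k \<Rightarrow> nat \<Rightarrow> real). fst (snd z) t)"
    and "continuous_on UNIV
      (\<lambda>z :: ('j \<Rightarrow> nat \<Rightarrow> real) \<times> (nat \<Rightarrow> real) \<times> ('j \<Rightarrow> 'k \<Rightarrow> nat \<Rightarrow> real). snd (snd z) i k t)"
proof -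
  note coordinate = continuous_on_product_then_coordinatewise
  have base:
    "continuous_on UNIV (\<lambda>z :: ('j \<Rightarrow> nat \<Rightarrow> real) \<times> (nat \<Rightarrow> real) \<times> ('j \<Rightarrow> 'k \<Rightarrow> nat \<Rightarrow> real). fst z)"
    "continuous_on UNIV (\<lambda>z :: ('j \<Rightarrow> nat \<Rightarrow> real) \<times> (nat \<Rightarrow> real) \<times> ('j \<Rightarrow> 'k \<Rightarrow> nat \<Rightarrow> real). fst (snd z))"
    "continuous_on UNIV (\<lambda>z :: ('j \<Rightarrow> nat \<Rightarrow> real) \<times> (nat \<Rightarrow> real) \<times> ('j \<Rightarrow> 'k \<Rightarrow> nat \<Rightarrow> real). snd (snd z))"
    by (intro continuous_on_fst continuous_on_snd continuous_on_id)+
  show "continuous_on UNIV (\<lambda>z :: ('j \<Rightarrow> nat \<Rightarrow> real) \<times> (nat \<Rightarrow> real) \<times> ('j \<Rightarrow> 'k \<Rightarrow> nat \<Rightarrow> real). fst z i t)"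
    by (rule coordinate[OF coordinate[OF base(1), of i], of t])
  show "continuous_on UNIV (\<lambda>z :: ('j \<Rightarrow> nat \<Rightarrow> real) \<times> (nat \<Rightarrow> real) \<times> ('j \<Rightarrow> 'k \<Rightarrow> nat \<Rightarrow> real). fst (snd z) t)"
    by (rule coordinate[OF base(2), of t])
  show "continuous_on UNIV (\<lambda>z :: ('j \<Rightarrow> nat \<Rightarrow> real) \<times> (nat \<Rightarrow> real) \<times> ('j \<Rightarrow> 'k \<Rightarrow> nat \<Rightarrow> real). snd (snd z) i k t)"
    by (rule coordinate[OF coordinate[OF coordinate[OF base(3), of i], of k], of t])
qed

lemma closed_FP2_feasible_set: "closed (feasible_set (FP2 P))"
  unfolding FP2_def resource_constraints_def case_prod_beta' Ball_def max_problem.simps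
  by (intro closed_Collect_conj closed_Collect_all closed_Collect_imp closed_Collect_le
      closed_Collect_eq closed_exp_cone_constraint open_Collect_const continuous_intros
      FP2_coordinates_continuous)

lemma continuous_FP2_objective: "continuous_on UNIV (objective (FP2 P))"
  unfolding FP2_def case_prod_beta' max_problem.simps
  by (intro continuous_intros FP2_coordinates_continuous)

text \<open>
  The objective is a sum of contributions of the pairs \<open>(t, j)\<close>, each bounded above by \<open>c\<close>. If
  the total is at least \<open>f\<close>, each contribution is therefore bounded below, and the entries of
  each pair can be replaced by bounded ones without changing their sum or their value.
\<close>

lemma FP2_bounded_representative:
  fixes P :: "('a, 'b, 'c) fluid_data"
  assumes valid: "valid_fluid_data P" and trade: "trade_off P"
  obtains B where "\<And>z. z \<in> feasible_set (FP2 P) \<Longrightarrow> f \<le> objective (FP2 P) z \<Longrightarrow>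
    \<exists>z' \<in> feasible_set (FP2 P) \<inter> coordinate_box B. objective (FP2 P) z' = objective (FP2 P) z"
proof -
  define I where "I = {..horizon P} \<times> products P"
  have finJ: "finite (products P)" using valid by (simp add: valid_fluid_data_def)
  then have finI: "finite I" by (simp add: I_def)
  have lam: "arrivals P t > 0" if "t \<le> horizon P" for t
    using valid that by (simp add: valid_fluid_data_def)
  have loc: "finite (attrs P j t)" "\<And>k. k \<in> attrs P j t \<Longrightarrow> phi P k t > 0"
    "\<And>k1 k2. k1 \<in> attrs P j t - attrs_ub P j t \<Longrightarrow> k2 \<in> attrs P j t - attrs_lb P j t \<Longrightarrow>
       phi P k1 t \<le> phi P k2 t"
    "\<And>k. k \<in> attrs_lb P j t \<inter> attrs_ub P j t \<Longrightarrow> lower P j k t \<le> upper P j k t"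
    if "j \<in> products P" "t \<le> horizon P" for j t
    using valid trade that by (auto simp: valid_fluid_data_def trade_off_def)
  define box_feasible where "box_feasible j t \<delta> v \<longleftrightarrow>
      (\<forall>k\<in>attrs_lb P j t. lower P j k t * \<delta> \<le> v k) \<and>
      (\<forall>k\<in>attrs_ub P j t. v k \<le> upper P j k t * \<delta>)" for j t \<delta> and v :: "'b \<Rightarrow> real"
  define entry_value where "entry_value j t v = (\<Sum>k\<in>attrs P j t. phi P k t * v k)" for j t and v :: "'b \<Rightarrow> real"
  define bounds_value where "bounds_value j t C \<longleftrightarrow> 0 \<le> C \<and> (\<forall>\<delta> v. 0 \<le> \<delta> \<longrightarrow> \<delta> \<le> 1 \<longrightarrow>
      box_feasible j t \<delta> v \<longrightarrow> sum v (attrs P j t) \<le> 1 \<longrightarrow> entry_value j t v \<le> C)" for j t C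
  define bounds_entries where "bounds_entries j t A B \<longleftrightarrow> (\<forall>\<delta> v. 0 \<le> \<delta> \<longrightarrow> \<delta> \<le> 1 \<longrightarrow>
      box_feasible j t \<delta> v \<longrightarrow> sum v (attrs P j t) \<le> 1 \<longrightarrow> A \<le> entry_value j t v \<longrightarrow>
      (\<exists>w. box_feasible j t \<delta> w \<and> sum w (attrs P j t) = sum v (attrs P j t) \<and>
        entry_value j t w = entry_value j t v \<and> (\<forall>k\<in>attrs P j t. \<bar>w k\<bar> \<le> B)))" for j t A B
  have "\<exists>C. bounds_value j t C" if jt: "j \<in> products P" "t \<le> horizon P" for j t
    unfolding bounds_value_def box_feasible_def entry_value_def
    by (rule weighted_sum_bounded_above[OF loc(1-3)[OF jt],
          where l = "\<lambda>k. lower P j k t" and h = "\<lambda>k. upper P j k t"])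
  then obtain C where C: "\<And>j t. j \<in> products P \<Longrightarrow> t \<le> horizon P \<Longrightarrow> bounds_value j t (C j t)"
    by metis
  define c where "c = (\<lambda>(t, j). arrivals P t * (C j t + \<bar>psi P j t\<bar>))"
  define A where "A j t = (f - sum c I) / arrivals P t - \<bar>psi P j t\<bar>" for j t
  have "\<exists>B. bounds_entries j t (A j t) B" if jt: "j \<in> products P" "t \<le> horizon P" for j t
    unfolding bounds_entries_def box_feasible_def entry_value_def
    by (rule bounded_representative[OF loc[OF jt]])
  then obtain b where b: "\<And>j t. j \<in> products P \<Longrightarrow> t \<le> horizon P \<Longrightarrow> bounds_entries j t (A j t) (b j t)"
    by metis
  define B where "B = 1 + (\<Sum>(t, j)\<in>I. \<bar>b j t\<bar>)"
  have B1: "B \<ge> 1" unfolding B_def by (simp add: sum_nonneg case_prod_beta)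
  have bB: "b j t \<le> B" if "j \<in> products P" "t \<le> horizon P" for j t
  proof -
    have "\<bar>b j t\<bar> \<le> (\<Sum>(t, j)\<in>I. \<bar>b j t\<bar>)"
      using member_le_sum[of "(t, j)" I "\<lambda>(t, j). \<bar>b j t\<bar>"] finI that by (auto simp: I_def)
    then show ?thesis by (simp add: B_def)
  qed
  show ?thesis
  proof (rule that[of B])
    fix z assume z: "z \<in> feasible_set (FP2 P)" "f \<le> objective (FP2 P) z"
    obtain d d0 u where zd: "z = (d, d0, u)" by (cases z)
    have feas: "(d, d0, u) \<in> feasible_set (FP2 P)" using z zd by simp
    have d: "0 \<le> d j t" "d j t \<le> 1" if "j \<in> products P" "t \<le> horizon P" for j t
      using FP2_demand_nonneg[OF feas that] FP2_shares_le_1(2)[OF valid feas that(2,1)] by auto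
    have d0: "0 \<le> d0 t" "d0 t \<le> 1" if "t \<le> horizon P" for t
      using FP2_outside_share_pos[OF valid feas that] FP2_shares_le_1(1)[OF valid feas that] by auto
    have af: "attribute_feasible P j t (d0 t) (d j t) (\<lambda>k. u j k t)"
      if "j \<in> products P" "t \<le> horizon P" for j t
      using feas that by (simp add: FP2_feasible_iff)
    have bf: "box_feasible j t (d j t) (\<lambda>k. u j k t)" if "j \<in> products P" "t \<le> horizon P" for j t
      using af[OF that] by (simp add: attribute_feasible_def box_feasible_def)
    have u1: "(\<Sum>k\<in>attrs P j t. u j k t) \<le> 1" if "j \<in> products P" "t \<le> horizon P" for j t
    proof -
      have "\<forall>y>0. (\<Sum>k\<in>attrs P j t. u j k t) \<le> y * d0 t - d j t * (1 + ln y)"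
        using af[OF that] by (auto simp: attribute_feasible_def exp_cone_iff_tangents)
      from this[rule_format, of 1] show ?thesis using d(1)[OF that] d0(2)[OF that(2)] by simp
    qed
    define g where "g = (\<lambda>(t, j). revenue P j t (d j t) (\<lambda>k. u j k t))"
    have psi: "\<bar>psi P j t * d j t\<bar> \<le> \<bar>psi P j t\<bar>" if "j \<in> products P" "t \<le> horizon P" for j t
      using d[OF that] by (simp add: abs_mult mult_left_le)
    have gc: "g i \<le> c i" if "i \<in> I" for i
    proof -
      obtain t j where i: "i = (t, j)" "j \<in> products P" "t \<le> horizon P"
        using \<open>i \<in> I\<close> by (auto simp: I_def)
      have "entry_value j t (\<lambda>k. u j k t) \<le> C j t"
        using C[OF i(2,3)] d[OF i(2,3)] bf[OF i(2,3)] u1[OF i(2,3)]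
        unfolding bounds_value_def by blast
      then have "entry_value j t (\<lambda>k. u j k t) - psi P j t * d j t \<le> C j t + \<bar>psi P j t\<bar>"
        using psi[OF i(2,3)] by linarith
      then show ?thesis using lam[OF i(3)] by (simp add: i g_def c_def revenue_def entry_value_def mult_left_mono)
    qed
    have c0: "0 \<le> c i" if "i \<in> I" for i
      using that C lam by (auto simp: bounds_value_def c_def I_def less_imp_le)
    have fg: "f \<le> sum g I"
      using z(2) by (simp add: zd FP2_objective g_def I_def sum.cartesian_product)
    have lowerA: "A j t \<le> entry_value j t (\<lambda>k. u j k t)"
      if jt: "j \<in> products P" "t \<le> horizon P" for j t
    proof -
      have "sum g I - sum c I \<le> g (t, j)"
        by (rule sum_lower_bound_imp_term_lower_bound[OF finI gc c0]) (use jt in \<open>auto simp: I_def\<close>)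
      then have "f - sum c I \<le> arrivals P t * (entry_value j t (\<lambda>k. u j k t) - psi P j t * d j t)"
        using fg by (simp add: g_def revenue_def entry_value_def)
      then have "(f - sum c I) / arrivals P t \<le> entry_value j t (\<lambda>k. u j k t) - psi P j t * d j t"
        using lam[OF jt(2)] by (simp add: pos_divide_le_eq mult.commute)
      then show ?thesis using psi[OF jt] unfolding A_def by linarith
    qed
    have "\<exists>w. box_feasible j t (d j t) w \<and> sum w (attrs P j t) = (\<Sum>k\<in>attrs P j t. u j k t) \<and>
        entry_value j t w = entry_value j t (\<lambda>k. u j k t) \<and> (\<forall>k\<in>attrs P j t. \<bar>w k\<bar> \<le> b j t)"
      if jt: "j \<in> products P" "t \<le> horizon P" for j t
      using b[OF jt] d[OF jt] bf[OF jt] u1[OF jt] lowerA[OF jt] unfolding bounds_entries_def by blast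
    then obtain w where w: "\<And>j t. j \<in> products P \<Longrightarrow> t \<le> horizon P \<Longrightarrow>
        box_feasible j t (d j t) (w j t) \<and> sum (w j t) (attrs P j t) = (\<Sum>k\<in>attrs P j t. u j k t) \<and>
        entry_value j t (w j t) = entry_value j t (\<lambda>k. u j k t) \<and> (\<forall>k\<in>attrs P j t. \<bar>w j t k\<bar> \<le> b j t)"
      by metis
    \<comment> \<open>Values outside the index sets are irrelevant and set to 0 so as to lie in the cube.\<close>
    define d' where "d' j t = (if j \<in> products P \<and> t \<le> horizon P then d j t else 0)" for j t
    define d0' where "d0' t = (if t \<le> horizon P then d0 t else 0)" for t
    define u' where "u' j k t =
      (if j \<in> products P \<and> t \<le> horizon P \<and> k \<in> attrs P j t then w j t k else 0)" for j k t
    have sub: "attrs_lb P j t \<subseteq> attrs P j t" "attrs_ub P j t \<subseteq> attrs P j t"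
      if "j \<in> products P" "t \<le> horizon P" for j t
      using valid that by (auto simp: valid_fluid_data_def)
    have "attribute_feasible P j t (d0' t) (d' j t) (\<lambda>k. u' j k t)"
      if jt: "j \<in> products P" "t \<le> horizon P" for j t
    proof -
      have "k \<in> attrs P j t" if "k \<in> attrs_lb P j t \<or> k \<in> attrs_ub P j t" for k
        using that sub[OF jt] by auto
      then show ?thesis
        using jt w[OF jt] af[OF jt] by (auto simp: attribute_feasible_def box_feasible_def d'_def d0'_def u'_def)
    qed
    moreover have "resource_constraints P d'"
      using feas by (simp add: FP2_feasible_iff resource_constraints_def d'_def)
    moreover have "d0' t + (\<Sum>j\<in>products P. d' j t) = 1" if "t \<le> horizon P" for t
      using feas that by (simp add: FP2_feasible_iff d'_def d0'_def)
    moreover have "(d' j t, d0' t, - (\<Sum>k\<in>attrs P j t. upper P j k t * d0' t)) \<in> exp_cone"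
      if "t \<le> horizon P" "j \<in> fully_upper_bounded P t" for j t
    proof -
      have "j \<in> products P" using that by (simp add: fully_upper_bounded_def)
      then show ?thesis using feas that by (simp add: FP2_feasible_iff d'_def d0'_def)
    qed
    ultimately have "(d', d0', u') \<in> feasible_set (FP2 P)"
      by (simp add: FP2_feasible_iff)
    moreover have "revenue P j t (d' j t) (\<lambda>k. u' j k t) = revenue P j t (d j t) (\<lambda>k. u j k t)"
      if jt: "j \<in> products P" "t \<le> horizon P" for j t
      using w[OF jt] jt by (simp add: revenue_def entry_value_def d'_def u'_def)
    then have "objective (FP2 P) (d', d0', u') = objective (FP2 P) (d, d0, u)"
      unfolding FP2_objective by (intro sum.cong refl) auto
    moreover have "(d', d0', u') \<in> coordinate_box B"
    proof -
      have "\<bar>d' j t\<bar> \<le> B" for j t using d[of j t] B1 by (auto simp: d'_def)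
      moreover have "\<bar>d0' t\<bar> \<le> B" for t using d0[of t] B1 by (auto simp: d0'_def)
      moreover have "\<bar>u' j k t\<bar> \<le> B" for j k t
        using w[of j t] bB[of j t] B1 by (force simp: u'_def)
      ultimately show ?thesis unfolding coordinate_box_def by (simp add: abs_le_iff minus_le_iff)
    qed
    ultimately show "\<exists>z' \<in> feasible_set (FP2 P) \<inter> coordinate_box B. objective (FP2 P) z' = objective (FP2 P) z"
      unfolding zd by blast
  qed
qed

text \<open>
  Any feasible point at least as good as a fixed one has an equally good representative in a
  compact set, so the maximum over that set is global.
\<close>

lemma FP2_optimal_exists:
  assumes valid: "valid_fluid_data P" and trade: "trade_off P" and feas: "feasible (FP2 P)"
  shows "\<exists>z. optimal_solution (FP2 P) z"
proof -
  obtain z0 where z0: "z0 \<in> feasible_set (FP2 P)" using feas by (auto simp: feasible_def)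
  obtain B where B: "\<And>z. z \<in> feasible_set (FP2 P) \<Longrightarrow> objective (FP2 P) z0 \<le> objective (FP2 P) z \<Longrightarrow>
    \<exists>z' \<in> feasible_set (FP2 P) \<inter> coordinate_box B. objective (FP2 P) z' = objective (FP2 P) z"
    using FP2_bounded_representative[OF valid trade] by blast
  let ?S = "feasible_set (FP2 P) \<inter> coordinate_box B"
  have "compact ?S" by (intro closed_Int_compact closed_FP2_feasible_set compact_coordinate_box)
  moreover have "?S \<noteq> {}" using B[OF z0] by auto
  moreover have "continuous_on ?S (objective (FP2 P))"
    using continuous_FP2_objective by (rule continuous_on_subset) simp
  ultimately obtain z where z: "z \<in> ?S" "\<And>y. y \<in> ?S \<Longrightarrow> objective (FP2 P) y \<le> objective (FP2 P) z"
    using continuous_attains_sup by metis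
  have "objective (FP2 P) z0 \<le> objective (FP2 P) z" using B[OF z0] z(2) by force
  then have "objective (FP2 P) y \<le> objective (FP2 P) z" if "y \<in> feasible_set (FP2 P)" for y
    using B[OF that] z(2) by force
  then have "optimal_solution (FP2 P) z"
    using z(1) unfolding optimal_solution_def is_arg_max_def by (auto simp del: split_paired_All simp: not_less)
  then show ?thesis ..
qed


section \<open>Unboundedness and attainment\<close>

lemma unbounded_imp_no_optimal:
  assumes "unbounded M"
  shows "\<not> optimal_solution M z"
  using assms unfolding unbounded_def optimal_solution_def is_arg_max_def bdd_above_def
  by (auto simp: not_less)

lemma FP2_unbounded:
  assumes "valid_fluid_data P" "feasible (FP2 P)" "\<not> trade_off P"
  shows "unbounded (FP2 P)"
proof -
  obtain d d0 u where feas: "(d, d0, u) \<in> feasible_set (FP2 P)"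
    using assms(2) by (auto simp: feasible_def)
  have "\<exists>z\<in>feasible_set (FP2 P). objective (FP2 P) z > N" for N
  proof -
    obtain u' where "(d, d0, u') \<in> feasible_set (FP2 P)" "objective (FP2 P) (d, d0, u') \<ge> N + 1"
      using FP2_not_trade_off_dominates[OF assms(1) feas assms(3)] by blast
    then show ?thesis by (intro bexI[of _ "(d, d0, u')"]) auto
  qed
  then show ?thesis using assms(2) unfolding unbounded_def by (auto simp: bdd_above_def not_le)
qed

lemma FP1_unbounded:
  assumes valid: "valid_fluid_data P" and feas: "(d, d0, u) \<in> feasible_set (FP2 P)"
    and pos: "positive_demand P d" and nt: "\<not> trade_off P"
  shows "unbounded (FP1 P)"
proof -
  have *: "\<exists>z\<in>feasible_set (FP1 P). objective (FP1 P) z > N" for N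
  proof -
    obtain u' where u': "(d, d0, u') \<in> feasible_set (FP2 P)" "objective (FP2 P) (d, d0, u') \<ge> N + 1"
      using FP2_not_trade_off_dominates[OF valid feas nt] by blast
    obtain x where "(d, x) \<in> feasible_set (FP1 P)"
      "objective (FP1 P) (d, x) \<ge> objective (FP2 P) (d, d0, u')"
      using FP2_positive_imp_FP1_dominates[OF valid u'(1) pos] by blast
    then show ?thesis using u'(2) by (intro bexI[of _ "(d, x)"]) auto
  qed
  then have "feasible (FP1 P)" unfolding feasible_def by blast
  then show ?thesis using * unfolding unbounded_def by (auto simp: bdd_above_def not_le)
qed

lemma FP1_feasible_imp_FP2_positive:
  assumes "valid_fluid_data P" "feasible (FP1 P)"
  shows "\<exists>d d0 u. (d, d0, u) \<in> feasible_set (FP2 P) \<and> positive_demand P d"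
proof -
  obtain d x where "(d, x) \<in> feasible_set (FP1 P)"
    using assms(2) by (auto simp: feasible_def)
  from FP1_feasible_imp_FP2_feasible[OF assms(1) this] show ?thesis by blast
qed

theorem theorem3p6:
  fixes P :: "('j, 'k, 'r) fluid_data"
  assumes "valid_fluid_data P"
  shows "(\<not> feasible (FP2 P) \<longrightarrow> \<not> feasible (FP1 P)) \<and>
    (feasible (FP2 P) \<longrightarrow>
      ((unbounded (FP2 P) \<longleftrightarrow> \<not> trade_off P) \<and>
       (unbounded (FP2 P) \<longrightarrow>
         (\<not> (\<exists>d d0 u. (d, d0, u) \<in> feasible_set (FP2 P) \<and> positive_demand P d) \<longrightarrow>
            \<not> feasible (FP1 P)) \<and>
         ((\<exists>d d0 u. (d, d0, u) \<in> feasible_set (FP2 P) \<and> positive_demand P d) \<longrightarrow>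
            unbounded (FP1 P)))) \<and>
      (((\<exists>z. optimal_solution (FP2 P) z) \<longleftrightarrow> trade_off P) \<and>
       (\<forall>d d0 u. optimal_solution (FP2 P) (d, d0, u) \<longrightarrow>
         (positive_demand P d \<longrightarrow>
            optimal_solution (FP1 P) (d, \<lambda>j k t. u j k t / d j t)) \<and>
         ((\<exists>j\<in>products P. \<exists>t\<le>horizon P. d j t = 0) \<longrightarrow> \<not> feasible (FP1 P)))))"
proof (rule conjI)
  show "\<not> feasible (FP2 P) \<longrightarrow> \<not> feasible (FP1 P)"
    using FP1_feasible_imp_FP2_positive[OF assms] by (auto simp: feasible_def)
next
  have opt: "trade_off P \<longleftrightarrow> (\<exists>z. optimal_solution (FP2 P) z)"
    and unb: "unbounded (FP2 P) \<longleftrightarrow> \<not> trade_off P" if "feasible (FP2 P)"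
    using FP2_optimal_exists[OF assms] FP2_unbounded[OF assms] unbounded_imp_no_optimal that by metis+
  show "feasible (FP2 P) \<longrightarrow>
      ((unbounded (FP2 P) \<longleftrightarrow> \<not> trade_off P) \<and>
       (unbounded (FP2 P) \<longrightarrow>
         (\<not> (\<exists>d d0 u. (d, d0, u) \<in> feasible_set (FP2 P) \<and> positive_demand P d) \<longrightarrow>
            \<not> feasible (FP1 P)) \<and>
         ((\<exists>d d0 u. (d, d0, u) \<in> feasible_set (FP2 P) \<and> positive_demand P d) \<longrightarrow>
            unbounded (FP1 P)))) \<and>
      (((\<exists>z. optimal_solution (FP2 P) z) \<longleftrightarrow> trade_off P) \<and>
       (\<forall>d d0 u. optimal_solution (FP2 P) (d, d0, u) \<longrightarrow>
         (positive_demand P d \<longrightarrow>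
            optimal_solution (FP1 P) (d, \<lambda>j k t. u j k t / d j t)) \<and>
         ((\<exists>j\<in>products P. \<exists>t\<le>horizon P. d j t = 0) \<longrightarrow> \<not> feasible (FP1 P))))"
    (is "_ \<longrightarrow> (?A \<and> ?B) \<and> ?C \<and> ?D")
  proof
    assume feas: "feasible (FP2 P)"
    have ?A using unb[OF feas] .
    moreover have ?B
      using FP1_feasible_imp_FP2_positive[OF assms] FP1_unbounded[OF assms] unb[OF feas] by blast
    moreover have ?C using opt[OF feas] by blast
    moreover have ?D
      using FP2_optimal_positive_imp_FP1_optimal[OF assms]
        FP2_optimal_zero_imp_FP1_infeasible[OF assms] by blast
    ultimately show "(?A \<and> ?B) \<and> ?C \<and> ?D" by blast
  qed
qed

end
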